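(* Let $p,q\geq 2$ and let $S_{1}\subset\mathbb{R}^{p}$ and $S_{2}\subset\mathbb{R}^{q}$ be two closed nowhere dense sets with no bounded connected component such that $\mathbb{R}^{p}\setminus S_{1}$ and $\mathbb{R}^{q}\setminus S_{2}$ are connected. Then there exists a function $u(x,y)$ that is separately subharmonic on $\mathbb{R}^{p}\times\mathbb{R}^{q}$, subharmonic on $(\mathbb{R}^{p}\times\mathbb{R}^{q})\setminus(S_{1}\times S_{2})$, and locally unbounded at each point of $S_{1}\times S_{2}$.
   Context: A function $v:\omega\to[-\infty,+\infty)$ on an open set $\omega\subset\mathbb{R}^{N}$ ($N\ge 2$) is subharmonic if it is upper semicontinuous, $v\not\equiv-\infty$, and for every ball $B(x,\rho)$ relatively compact in $\omega$ the value $v(x)$ is at most the mean of $v$ over the sphere $\partial B(x,\rho)$ with respect to surface measure. A function $u(x,y)$ on $\mathbb{R}^{p}\times\mathbb{R}^{q}$ is separately subharmonic if for every fixed $(a,b)\in\mathbb{R}^p\times\mathbb{R}^q$ the partial functions $x\mapsto u(x,b)$ and $y\mapsto u(a,y)$ are subharmonic on $\mathbb{R}^{p}$ and $\mathbb{R}^{q}$ respectively. A function is locally unbounded at a point if it is not bounded above on any neighborhood of that point. *)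

theory Defs
  imports "HOL-Analysis.Analysis"
begin

text \<open>
  \<open>\<real>\<^sup>N\<close> is a type of class \<open>euclidean_space\<close> with \<open>DIM('a) = N\<close>.  The product type
  \<open>'a \<times> 'b\<close> is again in this class; its norm is the Euclidean norm of
  \<open>\<real>\<^sup>p \<times> \<real>\<^sup>q = \<real>\<^bsup>p+q\<^esup>\<close> and its \<open>lborel\<close> is Lebesgue measure there.
\<close>

text \<open>
  The surface measure of \<open>A \<subseteq> sphere c r\<close>, \<open>r > 0\<close>, is the one of polar coordinates:
  \<open>N r\<^bsup>N-1\<^esup>\<close> times the Lebesgue measure of the part, inside the unit ball, of the cone
  \<open>{x. x \<noteq> 0 \<and> c + r x / |x| \<in> A}\<close> over \<open>A\<close>.  (A cone of height \<open>1\<close> over a subset of the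
  unit sphere of area \<open>\<sigma>\<close> has volume \<open>\<sigma> / N\<close>.)
\<close>

definition surface_measure :: "'a::euclidean_space \<Rightarrow> real \<Rightarrow> 'a measure" where
  "surface_measure c r =
     scale_measure (ennreal (real DIM('a) * r ^ (DIM('a) - 1)))
       (distr (restrict_space lborel (ball 0 1 - {0})) (restrict_space borel (sphere c r))
          (\<lambda>x. c + (r / norm x) *\<^sub>R x))"

text \<open>
  Positive part minus negative part.  Where this is used below the integrand is upper
  semicontinuous and less than \<open>\<infinity>\<close> on a compact sphere, hence bounded above, so the first
  term is finite and the value \<open>\<infinity> - \<infinity>\<close> does not arise; the integral may be \<open>-\<infinity>\<close>.
\<close>

definition ereal_integral :: "'a measure \<Rightarrow> ('a \<Rightarrow> ereal) \<Rightarrow> ereal" where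
  "ereal_integral M f =
     enn2ereal (\<integral>\<^sup>+x. e2ennreal (max 0 (f x)) \<partial>M) -
     enn2ereal (\<integral>\<^sup>+x. e2ennreal (max 0 (- f x)) \<partial>M)"

definition sphere_mean :: "('a::euclidean_space \<Rightarrow> ereal) \<Rightarrow> 'a \<Rightarrow> real \<Rightarrow> ereal" where
  "sphere_mean v c r =
     ereal_integral (surface_measure c r) v /
     enn2ereal (emeasure (surface_measure c r) (sphere c r))"

definition upper_semicontinuous_on :: "'a::topological_space set \<Rightarrow> ('a \<Rightarrow> ereal) \<Rightarrow> bool" where
  "upper_semicontinuous_on W v \<longleftrightarrow>
     (\<forall>t. openin (top_of_set W) {x \<in> W. v x < t})"

text \<open>
  Functions with values in \<open>[-\<infinity>, +\<infinity>)\<close> are \<open>ereal\<close>-valued functions avoiding \<open>\<infinity>\<close>;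
  the values of \<open>v\<close> outside \<open>W\<close> are irrelevant.  A ball is relatively compact in \<open>W\<close>
  iff the closed ball is contained in \<open>W\<close>.
\<close>

definition subharmonic_on :: "'a::euclidean_space set \<Rightarrow> ('a \<Rightarrow> ereal) \<Rightarrow> bool" where
  "subharmonic_on W v \<longleftrightarrow>
     open W \<and>
     (\<forall>x\<in>W. v x < \<infinity>) \<and>
     upper_semicontinuous_on W v \<and>
     (\<exists>x\<in>W. v x \<noteq> -\<infinity>) \<and>
     (\<forall>x r. 0 < r \<and> cball x r \<subseteq> W \<longrightarrow> v x \<le> sphere_mean v x r)"

definition separately_subharmonic ::
  "('a::euclidean_space \<times> 'b::euclidean_space \<Rightarrow> ereal) \<Rightarrow> bool" where
  "separately_subharmonic u \<longleftrightarrow>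
     (\<forall>a b. subharmonic_on UNIV (\<lambda>x. u (x, b)) \<and> subharmonic_on UNIV (\<lambda>y. u (a, y)))"

definition locally_unbounded_at :: "('a::topological_space \<Rightarrow> ereal) \<Rightarrow> 'a \<Rightarrow> bool" where
  "locally_unbounded_at u z \<longleftrightarrow>
     (\<forall>U. open U \<and> z \<in> U \<longrightarrow> \<not> (\<exists>M::real. \<forall>w\<in>U. u w \<le> ereal M))"

definition nowhere_dense :: "'a::topological_space set \<Rightarrow> bool" where
  "nowhere_dense S \<longleftrightarrow> interior (closure S) = {}"

end

theory Submission
  imports Defs
begin

text \<open>
  The function is \<open>u(x, y) = \<Sum>\<^sub>n v\<^sub>n(x) w\<^sub>n(y)\<close> with continuous subharmonic \<open>v\<^sub>n, w\<^sub>n \<ge> 0\<close> that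
  degenerate exactly along \<open>S1\<close> and \<open>S2\<close>: every point is a zero of \<open>v\<^sub>n\<close> for all large \<open>n\<close>, every
  point off \<open>S1\<close> has a neighbourhood on which \<open>v\<^sub>n\<close> vanishes for all large \<open>n\<close>, and near every
  point of \<open>S1\<close> it takes values that are at least \<open>n\<close> for all large \<open>n\<close>; likewise \<open>w\<^sub>n\<close> along
  \<open>S2\<close>.  If one variable is fixed, or if one stays near a point off \<open>S1 \<times> S2\<close>, the sum is finite,
  and products of nonnegative subharmonic functions of separate variables are subharmonic.  Near a
  point of \<open>S1 \<times> S2\<close> the \<open>n\<close>-th term alone reaches \<open>n\<^sup>2\<close>.

  Finding \<open>v\<^sub>n\<close> (\<open>spiked_sequence\<close>) comes down to this: given a compact set \<open>K\<close> and a point \<open>p\<close> in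
  the unbounded component of its complement, construct a nonnegative subharmonic function on the whole
  space that is zero on \<open>K\<close> and positive at \<open>p\<close> (\<open>escaping_function\<close>).  Start with a function of this
  kind that fails to be subharmonic only near \<open>p\<close>, and push the bad spot to infinity along a path: the
  maximum with a large multiple of a function that is positive around the old bad spot, at most \<open>0\<close>
  on \<open>K\<close>, and subharmonic except near a new spot nearby, is bad only near the new spot.  Here \<open>K\<close>
  consists of a compact piece of \<open>S1\<close> and a compact set at positive distance from \<open>S1\<close>, and \<open>p\<close> is
  close to \<open>S1\<close>.  Neither part of \<open>K\<close> separates \<open>p\<close> from infinity (the first because \<open>S1\<close> has
  connected complement, the second because the component of \<open>S1\<close> next to \<open>p\<close> is unbounded), and two
  disjoint closed sets that do not separate two points do not separate them together.

  Subharmonicity is handled through a pointwise second-order condition, \<open>nonneg_trace_jet\<close>: at every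
  point the function is bounded below, up to second order, by a quadratic polynomial that has the same
  value there and nonnegative Laplacian.  Smooth subharmonic functions satisfy it, it is local, and it
  is visibly stable under maxima, sums, orthogonal maps and products of nonnegative functions in
  separate variables.  For a continuous function it implies the sub-mean value inequality on all
  spheres (\<open>sphere_average_ge_center\<close>): averaging over suitable rotations about the centre preserves
  the condition, the value at the centre and the mean over the sphere, while it brings the maximum
  over the sphere as close to that mean as desired, and then the maximum principle applies.
\<close>

section \<open>Lower second-order jets with nonnegative trace\<close>

text \<open>
  A viscosity-type form of \<open>\<Delta>v(a) \<ge> 0\<close>: one quadratic polynomial with nonnegative Laplacian supports
  \<open>v\<close> from below at \<open>a\<close> up to \<open>o(|h|\<^sup>2)\<close>.  Demanding that such a support exists at each point, and
  not that all supports satisfy a sign condition, is what makes maxima of smooth functions and products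
  easy to treat.
\<close>

definition nonneg_trace_jet :: "('a::euclidean_space \<Rightarrow> real) \<Rightarrow> 'a \<Rightarrow> bool" where
  "nonneg_trace_jet v a \<longleftrightarrow>
     (\<exists>l A. linear A \<and> 0 \<le> (\<Sum>b\<in>Basis. b \<bullet> A b) \<and>
        (\<forall>e>0. \<forall>\<^sub>F h in nhds 0.
           v a + l \<bullet> h + h \<bullet> A h - e * (norm h)\<^sup>2 \<le> v (a + h)))"

lemma nonneg_trace_jetI:
  assumes "linear A" and "0 \<le> (\<Sum>b\<in>Basis. b \<bullet> A b)"
    and "\<And>e. e > 0 \<Longrightarrow> \<forall>\<^sub>F h in nhds 0.
           v a + l \<bullet> h + h \<bullet> A h - e * (norm h)\<^sup>2 \<le> v (a + h)"
  shows "nonneg_trace_jet v a"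
  using assms unfolding nonneg_trace_jet_def by blast

lemma nonneg_trace_jetE:
  assumes "nonneg_trace_jet v a"
  obtains l A where "linear A" and "0 \<le> (\<Sum>b\<in>Basis. b \<bullet> A b)"
    and "\<And>e. e > 0 \<Longrightarrow> \<forall>\<^sub>F h in nhds 0.
           v a + l \<bullet> h + h \<bullet> A h - e * (norm h)\<^sup>2 \<le> v (a + h)"
  using assms unfolding nonneg_trace_jet_def by blast

lemma eventually_nhds_shift:
  fixes a :: "'a::euclidean_space"
  assumes "\<forall>\<^sub>F x in nhds a. P x"
  shows "\<forall>\<^sub>F h in nhds 0. P (a + h)"
proof -
  have "((\<lambda>h. a + h) \<longlongrightarrow> a + 0) (nhds 0)"
    by (intro tendsto_intros filterlim_ident)
  then show ?thesis
    using assms by (simp add: filterlim_iff)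
qed

text \<open>
  The support of the smaller function also supports the larger one.  This gives locality of the
  condition and, with the active function in the smaller role, its stability under maxima.
\<close>

lemma nonneg_trace_jet_below:
  assumes "nonneg_trace_jet w a" and "w a = v a" and "\<forall>\<^sub>F x in nhds a. w x \<le> v x"
  shows "nonneg_trace_jet v a"
proof -
  obtain l A where "linear A" "0 \<le> (\<Sum>b\<in>Basis. b \<bullet> A b)"
    and j: "\<And>e. e > 0 \<Longrightarrow> \<forall>\<^sub>F h in nhds 0.
           w a + l \<bullet> h + h \<bullet> A h - e * (norm h)\<^sup>2 \<le> w (a + h)"
    by (rule nonneg_trace_jetE[OF assms(1)]) blast
  then show ?thesis
  proof (intro nonneg_trace_jetI[of A v a l])
    fix e :: real assume "e > 0"
    show "\<forall>\<^sub>F h in nhds 0. v a + l \<bullet> h + h \<bullet> A h - e * (norm h)\<^sup>2 \<le> v (a + h)"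
      using j[OF \<open>e > 0\<close>] eventually_nhds_shift[OF assms(3)]
      by eventually_elim (use assms(2) in auto)
  qed
qed

lemma nonneg_trace_jet_const: "nonneg_trace_jet (\<lambda>x. c) a"
  by (rule nonneg_trace_jetI[of "\<lambda>x. 0" _ _ 0]) (auto simp: linear_iff)

lemma nonneg_trace_jet_add:
  assumes "nonneg_trace_jet v a" "nonneg_trace_jet w a"
  shows "nonneg_trace_jet (\<lambda>x. v x + w x) a"
proof -
  obtain l A where A: "linear A" "0 \<le> (\<Sum>b\<in>Basis. b \<bullet> A b)"
    and j: "\<And>e. e > 0 \<Longrightarrow> \<forall>\<^sub>F h in nhds 0.
           v a + l \<bullet> h + h \<bullet> A h - e * (norm h)\<^sup>2 \<le> v (a + h)"
    by (rule nonneg_trace_jetE[OF assms(1)]) blast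
  obtain k B where B: "linear B" "0 \<le> (\<Sum>b\<in>Basis. b \<bullet> B b)"
    and j': "\<And>e. e > 0 \<Longrightarrow> \<forall>\<^sub>F h in nhds 0.
           w a + k \<bullet> h + h \<bullet> B h - e * (norm h)\<^sup>2 \<le> w (a + h)"
    by (rule nonneg_trace_jetE[OF assms(2)]) blast
  show ?thesis
  proof (rule nonneg_trace_jetI[of "\<lambda>x. A x + B x" _ a "l + k"])
    show "linear (\<lambda>x. A x + B x)"
      using A(1) B(1) by (rule linear_compose_add)
    show "0 \<le> (\<Sum>b\<in>Basis. b \<bullet> (A b + B b))"
      using A(2) B(2) by (simp add: inner_add_right sum.distrib)
    fix e :: real assume "e > 0"
    then have "e / 2 > 0" by simp
    show "\<forall>\<^sub>F h in nhds 0. v a + w a + (l + k) \<bullet> h + h \<bullet> (A h + B h) - e * (norm h)\<^sup>2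
        \<le> v (a + h) + w (a + h)"
      using j[OF \<open>e / 2 > 0\<close>] j'[OF \<open>e / 2 > 0\<close>]
      by eventually_elim (simp add: inner_add_left inner_add_right)
  qed
qed

lemma nonneg_trace_jet_cmult:
  assumes "nonneg_trace_jet v a" "0 \<le> c"
  shows "nonneg_trace_jet (\<lambda>x. c * v x) a"
proof (cases "c = 0")
  case True
  then show ?thesis
    by (simp add: nonneg_trace_jet_const)
next
  case False
  with assms(2) have c: "c > 0"
    by simp
  obtain l A where A: "linear A" "0 \<le> (\<Sum>b\<in>Basis. b \<bullet> A b)"
    and j: "\<And>e. e > 0 \<Longrightarrow> \<forall>\<^sub>F h in nhds 0.
           v a + l \<bullet> h + h \<bullet> A h - e * (norm h)\<^sup>2 \<le> v (a + h)"
    by (rule nonneg_trace_jetE[OF assms(1)]) blast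
  show ?thesis
  proof (rule nonneg_trace_jetI[of "\<lambda>x. c *\<^sub>R A x" _ a "c *\<^sub>R l"])
    show "linear (\<lambda>x. c *\<^sub>R A x)"
      using A(1) by (rule linear_compose_scale_right)
    show "0 \<le> (\<Sum>b\<in>Basis. b \<bullet> (c *\<^sub>R A b))"
      using A(2) c by (simp flip: sum_distrib_left)
    fix e :: real assume "e > 0"
    then have "e / c > 0" using c by simp
    show "\<forall>\<^sub>F h in nhds 0. c * v a + (c *\<^sub>R l) \<bullet> h + h \<bullet> (c *\<^sub>R A h) - e * (norm h)\<^sup>2
        \<le> c * v (a + h)"
      using j[OF \<open>e / c > 0\<close>]
    proof eventually_elim
      case (elim h)
      then have "c * (v a + l \<bullet> h + h \<bullet> A h - e / c * (norm h)\<^sup>2) \<le> c * v (a + h)"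
        using c by simp
      then show ?case
        using c by (simp add: algebra_simps)
    qed
  qed
qed

lemma nonneg_trace_jet_sum:
  assumes "finite I" "\<And>i. i \<in> I \<Longrightarrow> nonneg_trace_jet (v i) a"
  shows "nonneg_trace_jet (\<lambda>x. \<Sum>i\<in>I. v i x) a"
  using assms
  by (induction I rule: finite_induct) (auto intro: nonneg_trace_jet_const nonneg_trace_jet_add)

lemma nonneg_trace_jet_max:
  assumes "nonneg_trace_jet v a" "nonneg_trace_jet w a"
  shows "nonneg_trace_jet (\<lambda>x. max (v x) (w x)) a"
proof (cases "v a \<le> w a")
  case True
  then show ?thesis
    by (intro nonneg_trace_jet_below[OF assms(2)]) auto
next
  case False
  then show ?thesis
    by (intro nonneg_trace_jet_below[OF assms(1)]) auto
qed

lemma nonneg_trace_jet_translate: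
  assumes "nonneg_trace_jet v (c + a)"
  shows "nonneg_trace_jet (\<lambda>x. v (c + x)) a"
  using assms unfolding nonneg_trace_jet_def by (simp add: add.assoc)

lemma orthogonal_transformation_adjoint:
  fixes \<rho> :: "'a::euclidean_space \<Rightarrow> 'a"
  assumes "orthogonal_transformation \<rho>"
  shows "adjoint \<rho> x \<bullet> adjoint \<rho> y = x \<bullet> y"
proof -
  have lin: "linear \<rho>"
    using assms orthogonal_transformation_def by blast
  obtain x' where x': "x = \<rho> x'"
    using orthogonal_transformation_surj[OF assms] by (meson surjD)
  have "adjoint \<rho> (\<rho> x') \<bullet> z = x' \<bullet> z" for z
    using assms by (simp add: adjoint_clauses(2)[OF lin] orthogonal_transformation_def)
  then have "adjoint \<rho> (\<rho> x') = x'"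
    using vector_eq_rdot by blast
  then show ?thesis
    by (simp add: x' adjoint_works[OF lin])
qed

text \<open>
  The trace of \<open>\<rho>\<^sup>T A \<rho>\<close> is the trace of \<open>A\<close>; both sides are expanded in the standard basis.
\<close>

lemma trace_orthogonal_transformation:
  fixes \<rho> A :: "'a::euclidean_space \<Rightarrow> 'a"
  assumes \<rho>: "orthogonal_transformation \<rho>" and A: "linear A"
  shows "(\<Sum>b\<in>Basis. \<rho> b \<bullet> A (\<rho> b)) = (\<Sum>b\<in>Basis. b \<bullet> A b)"
proof -
  have lin: "linear \<rho>"
    using \<rho> orthogonal_transformation_def by blast
  have "(\<Sum>b\<in>Basis. \<rho> b \<bullet> A (\<rho> b)) = (\<Sum>b\<in>Basis. \<Sum>c\<in>Basis. (\<rho> b \<bullet> c) * (A (\<rho> b) \<bullet> c))"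
    by (intro sum.cong refl) (rule euclidean_inner)
  also have "\<dots> = (\<Sum>c\<in>Basis. \<Sum>b\<in>Basis. (\<rho> b \<bullet> c) * (A (\<rho> b) \<bullet> c))"
    by (rule sum.swap)
  also have "\<dots> = (\<Sum>c\<in>Basis. \<Sum>b\<in>Basis. (adjoint \<rho> c \<bullet> b) * (adjoint \<rho> (adjoint A c) \<bullet> b))"
    by (simp add: adjoint_clauses(2)[OF lin] adjoint_clauses(2)[OF A] inner_commute[of "A _"] inner_commute[of "\<rho> _"])
  also have "\<dots> = (\<Sum>c\<in>Basis. adjoint \<rho> c \<bullet> adjoint \<rho> (adjoint A c))"
    by (intro sum.cong refl) (rule euclidean_inner[symmetric])
  also have "\<dots> = (\<Sum>c\<in>Basis. c \<bullet> A c)"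
    by (simp add: orthogonal_transformation_adjoint[OF \<rho>] adjoint_works[OF A] inner_commute)
  finally show ?thesis .
qed

lemma nonneg_trace_jet_orthogonal:
  fixes \<rho> :: "'a::euclidean_space \<Rightarrow> 'a"
  assumes \<rho>: "orthogonal_transformation \<rho>" and "nonneg_trace_jet v (\<rho> a)"
  shows "nonneg_trace_jet (\<lambda>x. v (\<rho> x)) a"
proof -
  have lin: "linear \<rho>"
    using \<rho> orthogonal_transformation_def by blast
  obtain l A where A: "linear A" "0 \<le> (\<Sum>b\<in>Basis. b \<bullet> A b)"
    and j: "\<And>e. e > 0 \<Longrightarrow> \<forall>\<^sub>F h in nhds 0.
           v (\<rho> a) + l \<bullet> h + h \<bullet> A h - e * (norm h)\<^sup>2 \<le> v (\<rho> a + h)"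
    by (rule nonneg_trace_jetE[OF assms(2)]) blast
  show ?thesis
  proof (rule nonneg_trace_jetI[of "\<lambda>h. adjoint \<rho> (A (\<rho> h))" _ a "adjoint \<rho> l"])
    show "linear (\<lambda>h. adjoint \<rho> (A (\<rho> h)))"
      using linear_compose[OF linear_compose[OF lin A(1)] adjoint_linear[OF lin]]
      by (simp add: o_def)
    show "0 \<le> (\<Sum>b\<in>Basis. b \<bullet> adjoint \<rho> (A (\<rho> b)))"
      using A(2) by (simp add: adjoint_works lin trace_orthogonal_transformation[OF \<rho> A(1)])
    fix e :: real assume "e > 0"
    have "(\<rho> \<longlongrightarrow> \<rho> 0) (nhds 0)"
      using linear_continuous_at[of \<rho> 0] lin
      by (simp add: isCont_def linear_linear tendsto_at_iff_tendsto_nhds)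
    then have "filterlim \<rho> (nhds 0) (nhds 0)"
      using linear_0[OF lin] by simp
    then have "\<forall>\<^sub>F h in nhds 0.
           v (\<rho> a) + l \<bullet> \<rho> h + \<rho> h \<bullet> A (\<rho> h) - e * (norm (\<rho> h))\<^sup>2 \<le> v (\<rho> a + \<rho> h)"
      using eventually_compose_filterlim[OF j[OF \<open>e > 0\<close>]] by blast
    then show "\<forall>\<^sub>F h in nhds 0.
         v (\<rho> a) + adjoint \<rho> l \<bullet> h + h \<bullet> adjoint \<rho> (A (\<rho> h)) - e * (norm h)\<^sup>2
         \<le> v (\<rho> (a + h))"
      by eventually_elim
        (simp add: adjoint_clauses[OF lin] linear_add[OF lin] orthogonal_transformation_norm[OF \<rho>])
  qed
qed

lemma sum_Basis_prod:
  fixes f :: "'a::euclidean_space \<times> 'b::euclidean_space \<Rightarrow> 'c::comm_monoid_add"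
  shows "sum f Basis = (\<Sum>b\<in>Basis. f (b, 0)) + (\<Sum>b\<in>Basis. f (0, b))"
proof -
  have "sum f ((\<lambda>b. (b, 0)) ` Basis) = (\<Sum>b\<in>Basis. f (b, 0))"
    "sum f (Pair 0 ` Basis) = (\<Sum>b\<in>Basis. f (0, b))"
    by (auto simp: sum.reindex inj_on_def)
  then show ?thesis
    by (subst Basis_prod_def, subst sum.union_disjoint) auto
qed

text \<open>
  At a zero of the product the constant \<open>0\<close> supports it.  Elsewhere both factors are positive, so
  close to the point their quadratic minorants are positive too and may be multiplied.  In the
  product the only new second-order term is the mixed one \<open>(l \<bullet> h) (k \<bullet> h')\<close>, which has
  trace zero, so the trace is \<open>w b\<close> times the first trace plus \<open>v a\<close> times the second.
\<close>

lemma nonneg_trace_jet_mult: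
  fixes v :: "'a::euclidean_space \<Rightarrow> real" and w :: "'b::euclidean_space \<Rightarrow> real"
  assumes v: "nonneg_trace_jet v a" "\<And>x. 0 \<le> v x" and w: "nonneg_trace_jet w b" "\<And>y. 0 \<le> w y"
  shows "nonneg_trace_jet (\<lambda>z. v (fst z) * w (snd z)) (a, b)"
proof (cases "v a = 0 \<or> w b = 0")
  case True
  then show ?thesis
    using v(2) w(2) by (intro nonneg_trace_jet_below[OF nonneg_trace_jet_const[of 0]]) auto
next
  case False
  then have pos: "v a > 0" "w b > 0"
    using v(2)[of a] w(2)[of b] by auto
  obtain l A where A: "linear A" "0 \<le> (\<Sum>b\<in>Basis. b \<bullet> A b)"
    and j: "\<And>e. e > 0 \<Longrightarrow> \<forall>\<^sub>F h in nhds 0.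
           v a + l \<bullet> h + h \<bullet> A h - e * (norm h)\<^sup>2 \<le> v (a + h)"
    by (rule nonneg_trace_jetE[OF v(1)]) blast
  obtain k B where B: "linear B" "0 \<le> (\<Sum>b\<in>Basis. b \<bullet> B b)"
    and j': "\<And>e. e > 0 \<Longrightarrow> \<forall>\<^sub>F h in nhds 0.
           w b + k \<bullet> h + h \<bullet> B h - e * (norm h)\<^sup>2 \<le> w (b + h)"
    by (rule nonneg_trace_jetE[OF w(1)]) blast
  obtain CA where CA: "CA > 0" "\<And>x. norm (A x) \<le> CA * norm x"
    using linear_bounded_pos[OF A(1)] by blast
  obtain CB where CB: "CB > 0" "\<And>x. norm (B x) \<le> CB * norm x"
    using linear_bounded_pos[OF B(1)] by blast
  define L where "L = norm l + norm k"
  define C where "C = CA + CB + 1"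
  have LC: "L \<ge> 0" "C \<ge> 0"
    using CA(1) CB(1) by (auto simp: L_def C_def)
  \<comment> \<open>the mixed term is put entirely into the first component; \<open>Q\<close> need not be symmetric\<close>
  define Q where "Q z = (w b *\<^sub>R A (fst z) + (k \<bullet> snd z) *\<^sub>R l, v a *\<^sub>R B (snd z))" for z
  show ?thesis
  proof (rule nonneg_trace_jetI[of Q _ _ "(w b *\<^sub>R l, v a *\<^sub>R k)"])
    show "linear Q"
      using A(1) B(1)
      by (auto simp: Q_def linear_iff scaleR_add_right inner_add_right algebra_simps)
    show "0 \<le> (\<Sum>b\<in>Basis. b \<bullet> Q b)"
      using A B pos
      by (auto simp: Q_def sum_Basis_prod linear_0 simp flip: sum_distrib_left)
    fix e :: real assume "e > 0"
    \<comment> \<open>half of \<open>e\<close> pays for the errors of the two factors, half for the terms of order three and four\<close>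
    define d where "d = min 1 (e / (2 * (v a + w b)))"
    have "v a + w b > 0"
      using pos by simp
    moreover have "d \<le> e / 2 / (v a + w b)"
      by (simp add: d_def field_simps)
    ultimately have "d * (v a + w b) \<le> e / 2"
      by (simp only: pos_le_divide_eq)
    moreover have "d > 0" "d \<le> 1"
      using pos \<open>e > 0\<close> by (auto simp: d_def add_pos_pos)
    ultimately have d: "d > 0" "d \<le> 1" "d * (v a + w b) \<le> e / 2"
      by auto
    have fst0: "filterlim fst (nhds (0::'a)) (nhds (0::'a \<times> 'b))"
      using tendsto_fst[OF filterlim_ident, of "0::'a \<times> 'b"] by simp
    have snd0: "filterlim snd (nhds (0::'b)) (nhds (0::'a \<times> 'b))"
      using tendsto_snd[OF filterlim_ident, of "0::'a \<times> 'b"] by simp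
    have 1: "\<forall>\<^sub>F z::'a\<times>'b in nhds 0. v a + l \<bullet> fst z + fst z \<bullet> A (fst z) - d * (norm (fst z))\<^sup>2
        \<le> v (a + fst z)"
      using eventually_compose_filterlim[OF j[OF d(1)] fst0] by blast
    have 2: "\<forall>\<^sub>F z::'a\<times>'b in nhds 0. w b + k \<bullet> snd z + snd z \<bullet> B (snd z) - d * (norm (snd z))\<^sup>2
        \<le> w (b + snd z)"
      using eventually_compose_filterlim[OF j'[OF d(1)] snd0] by blast
    have lim: "((\<lambda>z::'a\<times>'b. c * norm z + c' * (norm z)\<^sup>2) \<longlongrightarrow> c * 0 + c' * 0\<^sup>2) (nhds 0)" for c c'
      using tendsto_norm[of "\<lambda>z. z" "0::'a\<times>'b" "nhds 0"] filterlim_ident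
      by (intro tendsto_intros) auto
    have 3: "\<forall>\<^sub>F z::'a\<times>'b in nhds 0. L * norm z + C * (norm z)\<^sup>2 < min (v a) (w b)"
      using order_tendstoD(2)[OF lim[of L C], of "min (v a) (w b)"] pos by simp
    have 4: "\<forall>\<^sub>F z::'a\<times>'b in nhds 0. (2 * L * C) * norm z + C\<^sup>2 * (norm z)\<^sup>2 < e / 2"
      using order_tendstoD(2)[OF lim[of "2 * L * C" "C\<^sup>2"], of "e / 2"] \<open>e > 0\<close> by simp
    from 1 2 3 4
    show "\<forall>\<^sub>F z in nhds 0. v (fst (a, b)) * w (snd (a, b)) + (w b *\<^sub>R l, v a *\<^sub>R k) \<bullet> z
        + z \<bullet> Q z - e * (norm z)\<^sup>2 \<le> v (fst ((a, b) + z)) * w (snd ((a, b) + z))"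
    proof eventually_elim
      case (elim z)
      obtain x y where z: "z = (x, y)" by force
      define s where "s = norm z"
      have s: "norm x \<le> s" "norm y \<le> s" "s \<ge> 0" "s\<^sup>2 = (norm x)\<^sup>2 + (norm y)\<^sup>2"
        by (auto simp: s_def z norm_Pair)
      define X Y X' Y' where "X = l \<bullet> x" and "Y = x \<bullet> A x - d * (norm x)\<^sup>2"
        and "X' = k \<bullet> y" and "Y' = y \<bullet> B y - d * (norm y)\<^sup>2"
      have X: "\<bar>X\<bar> \<le> L * s"
      proof -
        have "\<bar>X\<bar> \<le> norm l * norm x"
          unfolding X_def by (rule Cauchy_Schwarz_ineq2)
        also have "\<dots> \<le> L * s"
          using s LC by (intro mult_mono) (auto simp: L_def)
        finally show ?thesis .
      qed
      have X': "\<bar>X'\<bar> \<le> L * s"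
      proof -
        have "\<bar>X'\<bar> \<le> norm k * norm y"
          unfolding X'_def by (rule Cauchy_Schwarz_ineq2)
        also have "\<dots> \<le> L * s"
          using s LC by (intro mult_mono) (auto simp: L_def)
        finally show ?thesis .
      qed
      have quad: "\<bar>t \<bullet> D t - d * (norm t)\<^sup>2\<bar> \<le> (c + 1) * s\<^sup>2"
        if "norm t \<le> s" "norm (D t) \<le> c * norm t" "c \<ge> 0" for t :: "'c::euclidean_space" and D c
      proof -
        have "\<bar>t \<bullet> D t\<bar> \<le> norm t * norm (D t)"
          by (rule Cauchy_Schwarz_ineq2)
        also have "\<dots> \<le> norm t * (c * norm t)"
          using that by (intro mult_left_mono) auto
        also have "\<dots> = c * (norm t)\<^sup>2"
          by (simp add: power2_eq_square)
        finally have "\<bar>t \<bullet> D t - d * (norm t)\<^sup>2\<bar> \<le> c * (norm t)\<^sup>2 + d * (norm t)\<^sup>2"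
          using d(1) abs_triangle_ineq4[of "t \<bullet> D t" "d * (norm t)\<^sup>2"]
          by (simp add: abs_mult)
        also have "\<dots> \<le> (c + 1) * (norm t)\<^sup>2"
          using d(2) mult_right_mono[of d 1 "(norm t)\<^sup>2"] by (simp add: algebra_simps)
        also have "\<dots> \<le> (c + 1) * s\<^sup>2"
          using that by (intro mult_left_mono power_mono) auto
        finally show ?thesis .
      qed
      have "\<bar>Y\<bar> \<le> (CA + 1) * s\<^sup>2"
        unfolding Y_def using s CA by (intro quad) auto
      also have "\<dots> \<le> C * s\<^sup>2"
        using CB(1) by (intro mult_right_mono) (auto simp: C_def)
      finally have Y: "\<bar>Y\<bar> \<le> C * s\<^sup>2" .
      have "\<bar>Y'\<bar> \<le> (CB + 1) * s\<^sup>2"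
        unfolding Y'_def using s CB by (intro quad) auto
      also have "\<dots> \<le> C * s\<^sup>2"
        using CA(1) by (intro mult_right_mono) (auto simp: C_def)
      finally have Y': "\<bar>Y'\<bar> \<le> C * s\<^sup>2" .
      have low: "v a + X + Y \<le> v (a + x)" "w b + X' + Y' \<le> w (b + y)"
        using elim(1,2) by (auto simp: z X_def Y_def X'_def Y'_def)
      have "v a + X + Y \<ge> 0" "w b + X' + Y' \<ge> 0"
        using elim(3) X X' Y Y' by (auto simp: s_def)
      then have prod: "(v a + X + Y) * (w b + X' + Y') \<le> v (a + x) * w (b + y)"
        using low v(2) by (intro mult_mono) auto
      have e1: "\<bar>X * Y'\<bar> \<le> (L * s) * (C * s\<^sup>2)" "\<bar>Y * X'\<bar> \<le> (C * s\<^sup>2) * (L * s)"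
        "\<bar>Y * Y'\<bar> \<le> (C * s\<^sup>2) * (C * s\<^sup>2)"
        unfolding abs_mult using X X' Y Y' LC s by (auto intro!: mult_mono)
      have "(2 * L * C * s + C\<^sup>2 * s\<^sup>2) * s\<^sup>2 \<le> e / 2 * s\<^sup>2"
        using elim(4) by (intro mult_right_mono) (auto simp: s_def)
      then have e2: "(L * s) * (C * s\<^sup>2) + (C * s\<^sup>2) * (L * s) + (C * s\<^sup>2) * (C * s\<^sup>2) \<le> e / 2 * s\<^sup>2"
        by (simp add: algebra_simps power2_eq_square)
      have "w b * (d * (norm x)\<^sup>2) + v a * (d * (norm y)\<^sup>2)
          \<le> w b * (d * s\<^sup>2) + v a * (d * s\<^sup>2)"
        using pos d s by (intro add_mono mult_left_mono) auto
      also have "\<dots> = d * (v a + w b) * s\<^sup>2"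
        by (simp add: algebra_simps)
      also have "\<dots> \<le> e / 2 * s\<^sup>2"
        using d(3) by (intro mult_right_mono) auto
      finally have e3: "w b * (d * (norm x)\<^sup>2) + v a * (d * (norm y)\<^sup>2) \<le> e / 2 * s\<^sup>2" .
      have "v a * w b + (w b *\<^sub>R l, v a *\<^sub>R k) \<bullet> z + z \<bullet> Q z - e * (norm z)\<^sup>2
          = v a * w b + w b * X + v a * X' + w b * (x \<bullet> A x) + v a * (y \<bullet> B y) + X * X' - e * s\<^sup>2"
        by (simp add: z Q_def X_def X'_def s_def inner_add_right inner_commute algebra_simps)
      also have "\<dots> = (v a + X + Y) * (w b + X' + Y') - X * Y' - Y * X' - Y * Y'
          + (w b * (d * (norm x)\<^sup>2) + v a * (d * (norm y)\<^sup>2)) - e * s\<^sup>2"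
        by (simp add: Y_def Y'_def algebra_simps)
      also have "\<dots> \<le> (v a + X + Y) * (w b + X' + Y')"
        using e1 e2 e3 by linarith
      finally show ?case
        using prod by (simp add: z)
    qed
  qed
qed

text \<open>
  Otherwise \<open>g + \<epsilon> |x|\<^sup>2\<close> with a small \<open>\<epsilon>\<close> has an interior maximum.  There the supporting quadratic
  form of \<open>g\<close> is negative in every coordinate direction, which contradicts the sign of its trace.
\<close>

lemma maximum_principle:
  fixes g :: "'a::euclidean_space \<Rightarrow> real"
  assumes cont: "continuous_on (cball 0 R) g" and R: "R > 0"
    and jet: "\<And>x. norm x < R \<Longrightarrow> nonneg_trace_jet g x"
    and bd: "\<And>x. norm x = R \<Longrightarrow> g x \<le> M"
  shows "g 0 \<le> M"
proof (rule ccontr)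
  assume "\<not> g 0 \<le> M"
  define \<epsilon> where "\<epsilon> = (g 0 - M) / (2 * R\<^sup>2)"
  have \<epsilon>: "\<epsilon> > 0" "\<epsilon> * R\<^sup>2 = (g 0 - M) / 2"
    using \<open>\<not> g 0 \<le> M\<close> R by (auto simp: \<epsilon>_def)
  have "continuous_on (cball 0 R) (\<lambda>x. g x + \<epsilon> * (norm x)\<^sup>2)"
    by (intro continuous_intros cont)
  then obtain a where a: "a \<in> cball 0 R"
    "\<And>x. x \<in> cball 0 R \<Longrightarrow> g x + \<epsilon> * (norm x)\<^sup>2 \<le> g a + \<epsilon> * (norm a)\<^sup>2"
    using continuous_attains_sup[of "cball 0 R" "\<lambda>x. g x + \<epsilon> * (norm x)\<^sup>2"] R by auto
  have "norm a < R"
  proof (rule ccontr)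
    assume "\<not> norm a < R"
    then have "norm a = R"
      using a(1) by auto
    then have "g a \<le> M" "\<epsilon> * (norm a)\<^sup>2 = (g 0 - M) / 2"
      using bd[of a] \<epsilon>(2) by auto
    moreover have "g 0 \<le> g a + \<epsilon> * (norm a)\<^sup>2"
      using a(2)[of 0] R by simp
    ultimately show False
      using \<open>\<not> g 0 \<le> M\<close> by argo
  qed
  then obtain l A where A: "linear A" "0 \<le> (\<Sum>b\<in>Basis. b \<bullet> A b)"
    and j: "\<And>e. e > 0 \<Longrightarrow> \<forall>\<^sub>F h in nhds 0.
           g a + l \<bullet> h + h \<bullet> A h - e * (norm h)\<^sup>2 \<le> g (a + h)"
    by (rule nonneg_trace_jetE[OF jet]) blast
  have "\<forall>\<^sub>F x in nhds a. x \<in> ball 0 R"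
    using \<open>norm a < R\<close> by (intro eventually_nhds_in_open) auto
  from eventually_nhds_shift[OF this] j[of "\<epsilon>/2"] \<epsilon>(1)
  have "\<forall>\<^sub>F h in nhds 0. a + h \<in> ball 0 R \<and>
      g a + l \<bullet> h + h \<bullet> A h - \<epsilon> / 2 * (norm h)\<^sup>2 \<le> g (a + h)"
    by (auto intro: eventually_conj)
  then obtain d where d: "d > 0" and dj: "\<And>h. norm h < d \<Longrightarrow> a + h \<in> ball 0 R \<and>
      g a + l \<bullet> h + h \<bullet> A h - \<epsilon> / 2 * (norm h)\<^sup>2 \<le> g (a + h)"
    unfolding eventually_nhds_metric by (auto simp: dist_norm)
  have neg: "b \<bullet> A b < 0" if "b \<in> Basis" for b
  proof -
    define t where "t = d / 2"
    have t: "t > 0" "t < d" using d by (auto simp: t_def)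
    have "g a + l \<bullet> h + h \<bullet> A h - \<epsilon> / 2 * (norm h)\<^sup>2 \<le> g a - \<epsilon> * (2 * (a \<bullet> h) + (norm h)\<^sup>2)"
      if "norm h < d" for h
    proof -
      have "g (a + h) + \<epsilon> * (norm (a + h))\<^sup>2 \<le> g a + \<epsilon> * (norm a)\<^sup>2"
        using dj[OF that] by (intro a(2)) auto
      moreover have "(norm (a + h))\<^sup>2 = (norm a)\<^sup>2 + 2 * (a \<bullet> h) + (norm h)\<^sup>2"
        by (simp add: power2_norm_eq_inner inner_add_left inner_add_right inner_commute)
      ultimately show ?thesis
        using dj[OF that] by (simp add: algebra_simps)
    qed
    \<comment> \<open>adding the estimates for \<open>h\<close> and \<open>-h\<close> removes the linear terms\<close>
    from this[of "t *\<^sub>R b"] this[of "(- t) *\<^sub>R b"]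
    have "2 * t\<^sup>2 * (b \<bullet> A b) + \<epsilon> * t\<^sup>2 \<le> 0"
      using t that by (simp add: linear_scale[OF A(1)] linear_neg[OF A(1)] power2_eq_square algebra_simps)
    then have "t\<^sup>2 * (2 * (b \<bullet> A b) + \<epsilon>) \<le> 0"
      by (simp add: algebra_simps)
    then have "2 * (b \<bullet> A b) + \<epsilon> \<le> 0"
      using t by (simp add: mult_le_0_iff)
    then show ?thesis
      using \<epsilon>(1) by simp
  qed
  have "(\<Sum>b\<in>Basis. b \<bullet> A b) < 0"
    using neg sum_strict_mono[of "Basis :: 'a set" "\<lambda>b. b \<bullet> A b" "\<lambda>b. 0"] by simp
  then show False
    using A(2) by simp
qed

section \<open>Spherical means and their rotation invariance\<close>

text \<open>
  The computation behind the uniqueness of Haar measure: integrate \<open>1\<^sub>A(x) 1\<^sub>B(x + y)\<close> against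
  \<open>\<mu>(dx) dy\<close> in both orders, and translate \<open>x\<close> by \<open>-y\<close> in between.
\<close>

lemma emeasure_translation_invariant_swap:
  fixes \<mu> :: "'a::euclidean_space measure"
  assumes fin: "sigma_finite_measure \<mu>" and sets: "sets \<mu> = sets borel"
    and inv: "\<And>c. distr \<mu> borel ((+) c) = \<mu>"
    and A [measurable]: "A \<in> sets borel" and B [measurable]: "B \<in> sets borel"
  shows "emeasure \<mu> A * emeasure lborel B = emeasure \<mu> B * emeasure lborel (uminus -` A)"
proof -
  interpret \<mu>: sigma_finite_measure \<mu> by fact
  interpret P: pair_sigma_finite \<mu> lborel ..
  note [measurable_cong] = sets
  have A': "uminus -` A \<in> sets borel"
    using measurable_sets[OF borel_measurable_uminus[OF measurable_ident_sets[OF refl]] A] by simp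
  have tr: "(\<integral>\<^sup>+x. f (c + x) \<partial>\<nu>) = (\<integral>\<^sup>+x. f x \<partial>\<nu>)"
    if "distr \<nu> borel ((+) c) = \<nu>" "f \<in> borel_measurable borel" "sets \<nu> = sets borel"
    for f :: "'a \<Rightarrow> ennreal" and c \<nu>
  proof -
    note [measurable_cong] = that(3)
    have "(\<integral>\<^sup>+x. f x \<partial>distr \<nu> borel ((+) c)) = (\<integral>\<^sup>+x. f (c + x) \<partial>\<nu>)"
      using that(2) by (intro nn_integral_distr) measurable
    then show ?thesis
      using that(1) by simp
  qed
  have "emeasure \<mu> A * emeasure lborel B = (\<integral>\<^sup>+x. indicator A x * (\<integral>\<^sup>+y. indicator B (x + y) \<partial>lborel) \<partial>\<mu>)"
    by (simp add: tr[OF lborel_distr_plus, of "indicator B"] nn_integral_multc sets)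
  also have "\<dots> = (\<integral>\<^sup>+x. \<integral>\<^sup>+y. indicator A x * indicator B (x + y) \<partial>lborel \<partial>\<mu>)"
    by (intro nn_integral_cong nn_integral_cmult[symmetric]) auto
  also have "\<dots> = (\<integral>\<^sup>+y. \<integral>\<^sup>+x. indicator A x * indicator B (x + y) \<partial>\<mu> \<partial>lborel)"
    by (rule P.Fubini'[symmetric]) measurable
  also have "\<dots> = (\<integral>\<^sup>+y. \<integral>\<^sup>+x. indicator A (x - y) * indicator B x \<partial>\<mu> \<partial>lborel)"
  proof (rule nn_integral_cong)
    fix y
    show "(\<integral>\<^sup>+x. indicator A x * indicator B (x + y) \<partial>\<mu>) = (\<integral>\<^sup>+x. indicator A (x - y) * indicator B x \<partial>\<mu>)"
      using tr[OF inv _ sets, of "\<lambda>x. indicator A (x - y) * indicator B x" y]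
      by (simp add: add.commute)
  qed
  also have "\<dots> = (\<integral>\<^sup>+x. \<integral>\<^sup>+y. indicator A (x - y) * indicator B x \<partial>lborel \<partial>\<mu>)"
    by (rule P.Fubini') measurable
  also have "\<dots> = (\<integral>\<^sup>+x. (\<integral>\<^sup>+y. indicator A (x - y) \<partial>lborel) * indicator B x \<partial>\<mu>)"
    by (intro nn_integral_cong nn_integral_multc) auto
  also have "\<dots> = (\<integral>\<^sup>+x. emeasure lborel (uminus -` A) * indicator B x \<partial>\<mu>)"
  proof (rule nn_integral_cong)
    fix x
    have "(\<integral>\<^sup>+y. indicator A (x - y) \<partial>lborel) = (\<integral>\<^sup>+y. indicator (uminus -` A) (- x + y) \<partial>lborel)"
      by (intro nn_integral_cong) (auto simp: indicator_def)
    also have "\<dots> = emeasure lborel (uminus -` A)"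
      using A' by (subst tr[OF lborel_distr_plus]) auto
    finally show "(\<integral>\<^sup>+y. indicator A (x - y) \<partial>lborel) * indicator B x =
        emeasure lborel (uminus -` A) * indicator B x" by simp
  qed
  also have "\<dots> = emeasure \<mu> B * emeasure lborel (uminus -` A)"
    by (simp add: nn_integral_cmult sets) (simp add: mult.commute)
  finally show ?thesis .
qed

text \<open>
  The image measure is again translation invariant and agrees with Lebesgue measure on the unit ball.
  The previous lemma, applied to the image measure and to Lebesgue measure itself with \<open>B\<close> the unit
  ball, shows that they agree everywhere.
\<close>

lemma distr_lborel_orthogonal:
  fixes \<rho> :: "'a::euclidean_space \<Rightarrow> 'a"
  assumes \<rho>: "orthogonal_transformation \<rho>"
  shows "distr lborel borel \<rho> = lborel"
proof -
  define \<mu> where "\<mu> = distr lborel borel \<rho>"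
  have lin: "linear \<rho>"
    using \<rho> by (rule orthogonal_transformation_linear)
  have [measurable]: "\<rho> \<in> borel_measurable borel"
    using lin by (intro borel_measurable_continuous_onI linear_continuous_on) (simp add: linear_linear)
  have ball: "\<rho> -` ball 0 r = ball 0 r" for r
    by (auto simp: orthogonal_transformation_norm[OF \<rho>])
  have sets: "sets \<mu> = sets borel"
    by (simp add: \<mu>_def)
  have em: "emeasure \<mu> (ball 0 r) = emeasure lborel (ball (0::'a) r)" for r
    by (simp add: \<mu>_def emeasure_distr ball)
  have fin: "sigma_finite_measure \<mu>"
  proof
    show "\<exists>A. countable A \<and> A \<subseteq> sets \<mu> \<and> \<Union> A = space \<mu> \<and> (\<forall>a\<in>A. emeasure \<mu> a \<noteq> \<infinity>)"
    proof (intro exI[of _ "range (\<lambda>n::nat. ball 0 (real n))"] conjI)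
      show "\<Union> (range (\<lambda>n::nat. ball 0 (real n))) = space \<mu>"
        by (auto simp: \<mu>_def intro: reals_Archimedean2)
      show "\<forall>a\<in>range (\<lambda>n::nat. ball 0 (real n)). emeasure \<mu> a \<noteq> \<infinity>"
        using emeasure_lborel_ball_finite[of "0::'a"] by (auto simp: em less_top)
    qed (auto simp: sets)
  qed
  have inv: "distr \<mu> borel ((+) c) = \<mu>" for c
  proof -
    obtain c' where c': "c = \<rho> c'"
      using orthogonal_transformation_surj[OF \<rho>] by (meson surjD)
    have "distr \<mu> borel ((+) c) = distr lborel borel ((+) c \<circ> \<rho>)"
      by (simp add: \<mu>_def distr_distr)
    also have "(+) c \<circ> \<rho> = \<rho> \<circ> (+) c'"
      by (auto simp: c' linear_add[OF lin])
    also have "distr lborel borel (\<rho> \<circ> (+) c') = distr (distr lborel borel ((+) c')) borel \<rho>"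
      by (simp add: distr_distr)
    also have "\<dots> = \<mu>"
      by (simp add: lborel_distr_plus \<mu>_def)
    finally show ?thesis .
  qed
  have "emeasure lborel A = emeasure \<mu> A" if A: "A \<in> sets borel" for A
  proof -
    let ?B = "ball (0::'a) 1"
    have "emeasure \<mu> A * emeasure lborel ?B = emeasure \<mu> ?B * emeasure lborel (uminus -` A)"
      using fin sets inv A by (intro emeasure_translation_invariant_swap) auto
    moreover have "emeasure lborel A * emeasure lborel ?B = emeasure lborel ?B * emeasure lborel (uminus -` A)"
      using A by (intro emeasure_translation_invariant_swap sigma_finite_lborel lborel_distr_plus) auto
    ultimately have "emeasure lborel ?B * emeasure \<mu> A = emeasure lborel ?B * emeasure lborel A"
      by (simp add: em mult.commute)
    moreover have "emeasure lborel ?B \<noteq> top"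
      using emeasure_lborel_ball_finite[of "0::'a" 1] by simp
    moreover from this have "emeasure lborel ?B \<noteq> 0"
      using content_ball_pos[of 1 "0::'a"] by (simp add: emeasure_eq_ennreal_measure)
    ultimately show ?thesis
      by (simp add: ennreal_mult_cancel_left)
  qed
  then show ?thesis
    by (intro measure_eqI) (auto simp: \<mu>_def)
qed

text \<open>
  The mean over the sphere of radius \<open>r\<close> about the origin, written as a mean over the punctured unit
  ball of the radial extension; this is the form in which \<open>surface_measure\<close> presents it.
\<close>

definition sphere_average :: "('a::euclidean_space \<Rightarrow> real) \<Rightarrow> real \<Rightarrow> real" where
  "sphere_average f r =
     (LINT x:(ball 0 1 - {0})|lborel. f ((r / norm x) *\<^sub>R x)) / measure lborel (ball (0::'a) 1 - {0})"

lemma punctured_ball_measure: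
  "0 < measure lborel (ball (0::'a::euclidean_space) 1 - {0})"
  "emeasure lborel (ball (0::'a::euclidean_space) 1 - {0}) = ennreal (measure lborel (ball (0::'a) 1 - {0}))"
proof -
  have eq: "emeasure lborel (ball (0::'a) 1 - {0}) = emeasure lborel (ball (0::'a) 1)"
    by (rule emeasure_Diff_null_set) (auto simp: null_sets_def)
  have "emeasure lborel (ball (0::'a) 1) \<noteq> top"
    using emeasure_lborel_ball_finite[of "0::'a" 1] by simp
  moreover have "measure lborel (ball (0::'a) 1) > 0"
    by (simp add: content_ball_pos)
  moreover have "measure lborel (ball (0::'a) 1 - {0}) = measure lborel (ball (0::'a) 1)"
    unfolding measure_def eq ..
  ultimately show "0 < measure lborel (ball (0::'a) 1 - {0})"
    "emeasure lborel (ball (0::'a) 1 - {0}) = ennreal (measure lborel (ball (0::'a) 1 - {0}))"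
    unfolding eq by (simp_all add: emeasure_eq_ennreal_measure)
qed

lemma radial_projection_measurable:
  fixes f :: "'a::euclidean_space \<Rightarrow> real"
  assumes "continuous_on (sphere c r) f" "r > 0"
  shows "(\<lambda>x. indicat_real (ball 0 1 - {0}) x * f (c + (r / norm x) *\<^sub>R x)) \<in> borel_measurable borel"
proof -
  have "continuous_on (ball 0 1 - {0}) (\<lambda>x. f (c + (r / norm x) *\<^sub>R x))"
    using assms(2)
    by (intro continuous_on_compose2[OF assms(1)] continuous_intros) (auto simp: dist_norm split: if_splits)
  then have "(\<lambda>x. indicat_real (ball 0 1 - {0}) x *\<^sub>R f (c + (r / norm x) *\<^sub>R x)) \<in> borel_measurable borel"
    by (intro borel_measurable_continuous_on_indicator) auto
  then show ?thesis by simp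
qed

lemma radial_projection_integrable:
  fixes f :: "'a::euclidean_space \<Rightarrow> real"
  assumes "continuous_on (sphere 0 r) f" "r > 0"
  shows "set_integrable lborel (ball 0 1 - {0}) (\<lambda>x. f ((r / norm x) *\<^sub>R x))"
proof -
  have "compact (f ` sphere 0 r)"
    using assms(1) by (intro compact_continuous_image) auto
  then obtain C where C: "\<And>x. x \<in> sphere 0 r \<Longrightarrow> \<bar>f x\<bar> \<le> C"
    using compact_imp_bounded[of "f ` sphere 0 r"] unfolding bounded_iff real_norm_def by blast
  show ?thesis
    unfolding set_integrable_def
  proof (rule integrableI_bounded_set[of "ball 0 1 - {0}" _ _ C])
    show "(\<lambda>x. indicat_real (ball 0 1 - {0}) x *\<^sub>R f ((r / norm x) *\<^sub>R x)) \<in> borel_measurable lborel"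
      using radial_projection_measurable[OF assms] by simp
    show "emeasure lborel (ball (0::'a) 1 - {0}) < \<infinity>"
      by (subst punctured_ball_measure) simp
    show "AE x\<in>ball 0 1 - {0} in lborel.
        norm (indicat_real (ball 0 1 - {0}) x *\<^sub>R f ((r / norm x) *\<^sub>R x)) \<le> C"
      using assms(2) by (intro AE_I2) (auto intro!: C)
  qed auto
qed

lemma sphere_average_orthogonal:
  fixes \<rho> :: "'a::euclidean_space \<Rightarrow> 'a"
  assumes \<rho>: "orthogonal_transformation \<rho>" and cont: "continuous_on (sphere 0 r) f" and r: "r > 0"
  shows "sphere_average (\<lambda>x. f (\<rho> x)) r = sphere_average f r"
proof -
  have lin: "linear \<rho>"
    using \<rho> by (rule orthogonal_transformation_linear)
  have [measurable]: "\<rho> \<in> borel_measurable borel"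
    using lin by (intro borel_measurable_continuous_onI linear_continuous_on) (simp add: linear_linear)
  let ?F = "\<lambda>x. indicat_real (ball 0 1 - {0}) x *\<^sub>R f ((r / norm x) *\<^sub>R x)"
  have F: "?F \<in> borel_measurable borel"
    using radial_projection_measurable[OF cont r] by simp
  have "(LINT x|lborel. ?F x) = (LINT x|distr lborel borel \<rho>. ?F x)"
    by (simp add: distr_lborel_orthogonal[OF \<rho>])
  also have "\<dots> = (LINT x|lborel. ?F (\<rho> x))"
    using F by (intro integral_distr) auto
  also have "\<dots> = (LINT x|lborel. indicat_real (ball 0 1 - {0}) x *\<^sub>R f (\<rho> ((r / norm x) *\<^sub>R x)))"
  proof (intro Bochner_Integration.integral_cong refl)
    fix x
    have "\<rho> x = 0 \<longleftrightarrow> x = 0"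
      using orthogonal_transformation_norm[OF \<rho>, of x] by auto
    then have "indicat_real (ball 0 1 - {0}) (\<rho> x) = indicat_real (ball 0 1 - {0}) x"
      by (auto simp: indicator_def orthogonal_transformation_norm[OF \<rho>])
    then show "?F (\<rho> x) = indicat_real (ball 0 1 - {0}) x *\<^sub>R f (\<rho> ((r / norm x) *\<^sub>R x))"
      by (simp add: orthogonal_transformation_norm[OF \<rho>] linear_scale[OF lin])
  qed
  finally show ?thesis
    unfolding sphere_average_def set_lebesgue_integral_def by simp
qed

lemma sphere_average_sum:
  assumes "finite I" "\<And>i. i \<in> I \<Longrightarrow> continuous_on (sphere 0 r) (f i)" "r > 0"
  shows "sphere_average (\<lambda>x. \<Sum>i\<in>I. f i x) r = (\<Sum>i\<in>I. sphere_average (f i) r)"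
proof -
  have int: "integrable lborel (\<lambda>x. indicat_real (ball 0 1 - {0}) x *\<^sub>R f i ((r / norm x) *\<^sub>R x))"
    if "i \<in> I" for i
    using radial_projection_integrable[OF assms(2)[OF that] assms(3)]
    unfolding set_integrable_def .
  have "(LINT x:(ball 0 1 - {0})|lborel. (\<Sum>i\<in>I. f i ((r / norm x) *\<^sub>R x)))
     = (\<Sum>i\<in>I. LINT x:(ball 0 1 - {0})|lborel. f i ((r / norm x) *\<^sub>R x))"
    unfolding set_lebesgue_integral_def scaleR_sum_right
    by (rule Bochner_Integration.integral_sum) (rule int)
  then show ?thesis
    unfolding sphere_average_def by (simp add: sum_divide_distrib)
qed

lemma sphere_average_divide:
  "sphere_average (\<lambda>x. f x / c) r = sphere_average f r / c"
  unfolding sphere_average_def by simp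

lemma exists_le_sphere_average:
  fixes f :: "'a::euclidean_space \<Rightarrow> real"
  assumes cont: "continuous_on (sphere 0 r) f" and r: "r > 0"
  obtains x where "x \<in> sphere 0 r" and "f x \<le> sphere_average f r"
proof -
  have "\<exists>x\<in>sphere 0 r. f x \<le> sphere_average f r"
  proof -
    obtain b :: 'a where "b \<in> Basis" using nonempty_Basis by blast
    then have "r *\<^sub>R b \<in> sphere 0 r" using r by simp
    then obtain m where m: "m \<in> sphere 0 r" "\<And>x. x \<in> sphere 0 r \<Longrightarrow> f m \<le> f x"
      using continuous_attains_inf[OF compact_sphere _ cont] by blast
    let ?D = "ball (0::'a) 1 - {0}"
    have "measure lborel ?D * f m = (LINT x:?D|lborel. f m)"
      by (subst set_integral_const) (auto simp: punctured_ball_measure)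
    also have "\<dots> \<le> (LINT x:?D|lborel. f ((r / norm x) *\<^sub>R x))"
      using radial_projection_integrable[OF cont r] r
      by (intro set_integral_mono) (auto intro!: m(2) simp: set_integrable_def punctured_ball_measure)
    finally have "f m \<le> sphere_average f r"
      using punctured_ball_measure(1)[where 'a='a]
      by (simp add: sphere_average_def field_simps)
    with m show ?thesis by blast
  qed
  with that show thesis by blast
qed

lemma sphere_mean_eq_sphere_average:
  fixes f :: "'a::euclidean_space \<Rightarrow> real"
  assumes cont: "continuous_on (sphere c r) f" and r: "r > 0"
  shows "sphere_mean (\<lambda>x. ereal (f x)) c r = ereal (sphere_average (\<lambda>x. f (c + x)) r)"
proof -
  let ?D = "ball (0::'a) 1 - {0}"
  let ?\<phi> = "\<lambda>x::'a. c + (r / norm x) *\<^sub>R x"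
  define C where "C = real DIM('a) * r ^ (DIM('a) - 1)"
  define V where "V = measure lborel ?D"
  define I where "I = (LINT x:?D|lborel. f (?\<phi> x))"
  have C: "C > 0" and V: "V > 0"
    using r punctured_ball_measure(1)[where 'a='a] by (auto simp: C_def V_def)
  have int: "set_integrable lborel ?D (\<lambda>x. f (?\<phi> x))"
    by (rule radial_projection_integrable[OF _ r])
      (auto intro!: continuous_on_compose2[OF cont] continuous_intros simp: dist_norm)
  have \<phi>: "?\<phi> \<in> measurable (restrict_space lborel ?D) (restrict_space borel (sphere c r))"
  proof (rule measurable_restrict_space2)
    show "?\<phi> \<in> space (restrict_space lborel ?D) \<rightarrow> sphere c r"
      using r by (auto simp: space_restrict_space dist_norm)
    show "?\<phi> \<in> borel_measurable (restrict_space lborel ?D)"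
      by (rule measurable_restrict_space1) measurable
  qed
  have nn: "(\<integral>\<^sup>+x. ennreal (g x) \<partial>surface_measure c r)
      = ennreal C * (\<integral>\<^sup>+x. ennreal (indicat_real ?D x *\<^sub>R g (?\<phi> x)) \<partial>lborel)"
    if g: "continuous_on (sphere c r) g" for g :: "'a \<Rightarrow> real"
  proof -
    have [measurable]: "g \<in> borel_measurable (restrict_space borel (sphere c r))"
      using g by (rule borel_measurable_continuous_on_restrict)
    have "(\<integral>\<^sup>+x. ennreal (g x) \<partial>surface_measure c r)
        = ennreal C * (\<integral>\<^sup>+x. ennreal (g (?\<phi> x)) \<partial>restrict_space lborel ?D)"
      unfolding surface_measure_def C_def
      by (subst nn_integral_scale_measure, measurable, subst nn_integral_distr[OF \<phi>]) auto
    also have "(\<integral>\<^sup>+x. ennreal (g (?\<phi> x)) \<partial>restrict_space lborel ?D)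
        = (\<integral>\<^sup>+x. ennreal (g (?\<phi> x)) * indicator ?D x \<partial>lborel)"
      by (rule nn_integral_restrict_space) auto
    also have "\<dots> = (\<integral>\<^sup>+x. ennreal (indicat_real ?D x *\<^sub>R g (?\<phi> x)) \<partial>lborel)"
      by (intro nn_integral_cong) (auto simp: indicator_def)
    finally show ?thesis .
  qed
  have max0: "e2ennreal (max 0 (ereal t)) = ennreal t" for t
    by (simp add: ennreal_def)
  let ?P = "\<integral>\<^sup>+x. ennreal (indicat_real ?D x *\<^sub>R f (?\<phi> x)) \<partial>lborel"
  let ?N = "\<integral>\<^sup>+x. ennreal (- (indicat_real ?D x *\<^sub>R f (?\<phi> x))) \<partial>lborel"
  have fin: "?P \<noteq> \<infinity>" "?N \<noteq> \<infinity>" and I: "I = enn2real ?P - enn2real ?N"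
    using int real_lebesgue_integral_def[of lborel "\<lambda>x. indicat_real ?D x *\<^sub>R f (?\<phi> x)"]
    unfolding set_integrable_def real_integrable_def I_def set_lebesgue_integral_def by auto
  have conv: "enn2ereal (ennreal C * X) = ereal (C * enn2real X)" if "X \<noteq> \<infinity>" for X
    using that C by (cases X) (auto simp: ennreal_mult[symmetric])
  have "ereal_integral (surface_measure c r) (\<lambda>x. ereal (f x))
      = enn2ereal (\<integral>\<^sup>+x. ennreal (f x) \<partial>surface_measure c r) -
        enn2ereal (\<integral>\<^sup>+x. ennreal (- f x) \<partial>surface_measure c r)"
    by (simp add: ereal_integral_def max0)
  also have "\<dots> = ereal (C * enn2real ?P) - ereal (C * enn2real ?N)"
    using nn[OF cont] nn[OF continuous_on_minus[OF cont]] fin by (simp add: conv)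
  also have "\<dots> = ereal (C * I)"
    by (simp add: I algebra_simps)
  finally have num: "ereal_integral (surface_measure c r) (\<lambda>x. ereal (f x)) = ereal (C * I)" .
  have "emeasure (surface_measure c r) (sphere c r) = ennreal C * emeasure lborel ?D"
  proof -
    have pre: "?\<phi> -` sphere c r \<inter> space (restrict_space lborel ?D) = ?D"
      using r by (auto simp: space_restrict_space dist_norm)
    have "sphere c r \<in> sets (restrict_space borel (sphere c r))"
      using sets.top[of "restrict_space borel (sphere c r)"] by (simp add: space_restrict_space)
    then have "emeasure (distr (restrict_space lborel ?D) (restrict_space borel (sphere c r)) ?\<phi>) (sphere c r)
        = emeasure (restrict_space lborel ?D) (?\<phi> -` sphere c r \<inter> space (restrict_space lborel ?D))"
      by (rule emeasure_distr[OF \<phi>])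
    also have "\<dots> = emeasure (restrict_space lborel ?D) ?D"
      unfolding pre ..
    also have "\<dots> = emeasure lborel ?D"
      by (rule emeasure_restrict_space) auto
    finally show ?thesis
      unfolding surface_measure_def C_def by simp
  qed
  then have "enn2ereal (emeasure (surface_measure c r) (sphere c r)) = ereal (C * V)"
    using C V by (simp add: punctured_ball_measure V_def ennreal_mult[symmetric])
  with num have "sphere_mean (\<lambda>x. ereal (f x)) c r = ereal (C * I / (C * V))"
    unfolding sphere_mean_def using C V by simp
  also have "C * I / (C * V) = sphere_average (\<lambda>x. f (c + x)) r"
    using C by (simp add: sphere_average_def I_def V_def)
  finally show ?thesis .
qed

section \<open>From jets to the sub-mean value property\<close>

text \<open>
  The reflection in the hyperplane orthogonal to \<open>x - y\<close>; for \<open>x = y\<close> the quotient by zero makes it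
  the identity.
\<close>

lemma reflection_exists:
  fixes x y :: "'a::euclidean_space"
  assumes "norm x = norm y"
  obtains \<rho> where "orthogonal_transformation \<rho>" and "\<rho> x = y"
proof -
  define u where "u = x - y"
  define k where "k = 2 / (u \<bullet> u)"
  define \<rho> where "\<rho> z = z - (k * (u \<bullet> z)) *\<^sub>R u" for z
  have xy: "x \<bullet> x = y \<bullet> y"
    using assms by (simp add: dot_square_norm)
  have k: "k * k * (u \<bullet> u) = 2 * k"
    by (simp add: k_def)
  have "linear \<rho>"
    unfolding \<rho>_def
    by (rule linearI) (simp_all add: inner_add_right distrib_left scaleR_add_left scaleR_diff_right ac_simps)
  moreover have "\<rho> z \<bullet> \<rho> w = z \<bullet> w" for z w
  proof -
    have "\<rho> z \<bullet> \<rho> w = z \<bullet> w - 2 * k * ((u \<bullet> z) * (u \<bullet> w)) + (k * k * (u \<bullet> u)) * ((u \<bullet> z) * (u \<bullet> w))"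
      by (simp add: \<rho>_def inner_diff_left inner_diff_right inner_commute[of z u] inner_commute[of w u]
          algebra_simps)
    then show ?thesis
      by (simp add: k)
  qed
  moreover have "\<rho> x = y"
  proof (cases "u = 0")
    case False
    have "u \<bullet> u = 2 * (u \<bullet> x)"
      using xy by (simp add: u_def inner_diff_left inner_diff_right inner_commute)
    moreover have "u \<bullet> u \<noteq> 0"
      using False by simp
    ultimately have "k * (u \<bullet> x) = 1"
      by (simp add: k_def)
    then show ?thesis
      by (simp add: \<rho>_def) (simp add: u_def)
  qed (simp add: \<rho>_def u_def)
  ultimately show thesis
    using that unfolding orthogonal_transformation_def by blast
qed

text \<open>
  Suppose the mean \<open>m0\<close> over the sphere is smaller than \<open>v 0\<close> by \<open>\<eta>\<close>.  Consider the class \<open>H\<close> of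
  functions on the ball that share with \<open>v\<close> the jet condition, the value at \<open>0\<close>, the mean over the sphere
  and one modulus of continuity there.  If \<open>g\<close> in \<open>H\<close> is at most \<open>M\<close> on the sphere, then
  \<open>M \<ge> v 0 = m0 + \<eta>\<close> by the maximum principle, but \<open>g\<close> is at most \<open>m0\<close> at some point \<open>m\<close>.  For each
  point \<open>x\<close> of a finite net of \<open>K\<close> points on the sphere, compose \<open>g\<close> with an orthogonal map taking \<open>x\<close>
  to \<open>m\<close>.  At each point of the sphere one of these compositions is at most \<open>M - \<eta>/2\<close>, so their
  arithmetic mean, which lies in \<open>H\<close> again, is at most \<open>M - \<eta>/(2K)\<close> on the sphere.  As \<open>K\<close> and \<open>\<eta>\<close>
  stay fixed, iteration brings the bound below \<open>v 0\<close>.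
\<close>

lemma sphere_average_ge_center:
  fixes v :: "'a::euclidean_space \<Rightarrow> real"
  assumes cont: "continuous_on (cball 0 R) v" and R: "R > 0"
    and jet: "\<And>x. norm x < R \<Longrightarrow> nonneg_trace_jet v x"
  shows "v 0 \<le> sphere_average v R"
proof (rule ccontr)
  assume "\<not> v 0 \<le> sphere_average v R"
  define m0 where "m0 = sphere_average v R"
  define \<eta> where "\<eta> = v 0 - m0"
  have \<eta>: "\<eta> > 0"
    using \<open>\<not> v 0 \<le> sphere_average v R\<close> by (simp add: \<eta>_def m0_def)
  have sub: "sphere 0 R \<subseteq> cball (0::'a) R"
    by auto
  have cont_sphere: "continuous_on (sphere 0 R) v"
    using cont sub by (rule continuous_on_subset)
  obtain \<delta> where \<delta>: "\<delta> > 0" and unif: "\<And>x y. \<lbrakk>x \<in> sphere 0 R; y \<in> sphere 0 R; dist x y < \<delta>\<rbrakk>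
      \<Longrightarrow> dist (v x) (v y) < \<eta> / 2"
    using compact_uniformly_continuous[OF cont_sphere compact_sphere] \<eta>
    unfolding uniformly_continuous_on_def by (metis half_gt_zero)
  obtain X where X: "finite X" "X \<subseteq> sphere 0 R" "sphere (0::'a) R \<subseteq> (\<Union>x\<in>X. ball x \<delta>)"
  proof -
    have "sphere (0::'a) R \<subseteq> (\<Union>x\<in>sphere 0 R. ball x \<delta>)"
      using \<delta> by auto
    then show thesis
      using compactE_image[OF compact_sphere[of "0::'a" R], of "sphere 0 R" "\<lambda>x. ball x \<delta>"] that
      by (metis open_ball)
  qed
  have "sphere (0::'a) R \<noteq> {}"
    using R by simp
  then have "X \<noteq> {}"
    using X(3) by auto
  define K where "K = real (card X)"
  have K: "K > 0"
    using \<open>X \<noteq> {}\<close> X(1) by (simp add: K_def card_gt_0_iff)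
  define H where "H g \<longleftrightarrow> continuous_on (cball 0 R) g \<and> (\<forall>x. norm x < R \<longrightarrow> nonneg_trace_jet g x)
      \<and> g 0 = v 0 \<and> sphere_average g R = m0
      \<and> (\<forall>x\<in>sphere 0 R. \<forall>y\<in>sphere 0 R. dist x y < \<delta> \<longrightarrow> \<bar>g x - g y\<bar> \<le> \<eta> / 2)" for g :: "'a \<Rightarrow> real"
  have above: "v 0 \<le> M" if "H g" "\<And>x. x \<in> sphere 0 R \<Longrightarrow> g x \<le> M" for g M
    using maximum_principle[of R g M] that R by (auto simp: H_def)
  have step: "\<exists>g'. H g' \<and> (\<forall>x\<in>sphere 0 R. g' x \<le> M - \<eta> / (2 * K))"
    if g: "H g" and bd: "\<And>x. x \<in> sphere 0 R \<Longrightarrow> g x \<le> M" for g M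
  proof -
    have gc1: "continuous_on (cball 0 R) g"
      using g by (simp add: H_def)
    note gc = gc1 continuous_on_subset[OF gc1 sub]
    obtain m where m: "m \<in> sphere 0 R" "g m \<le> m0"
      using exists_le_sphere_average[OF gc(2) R] g by (auto simp: H_def)
    have "\<forall>x\<in>X. \<exists>\<rho>. orthogonal_transformation \<rho> \<and> \<rho> x = m"
      using X(2) m(1) reflection_exists[of _ m] by (metis mem_sphere_0 subsetD)
    then obtain \<rho> where \<rho>: "\<And>x. x \<in> X \<Longrightarrow> orthogonal_transformation (\<rho> x)" "\<And>x. x \<in> X \<Longrightarrow> \<rho> x x = m"
      by metis
    have lin: "linear (\<rho> x)" if "x \<in> X" for x
      using \<rho>(1)[OF that] by (rule orthogonal_transformation_linear)
    have norm: "norm (\<rho> x y) = norm y" if "x \<in> X" for x y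
      using \<rho>(1)[OF that] by (rule orthogonal_transformation_norm)
    have dist: "dist (\<rho> x y) (\<rho> x z) = dist y z" if "x \<in> X" for x y z
      by (simp add: dist_norm linear_diff[OF lin[OF that], symmetric] norm[OF that])
    have cont\<rho>: "continuous_on A (\<lambda>y. g (\<rho> x y))" if "x \<in> X" "continuous_on A g" "\<rho> x ` A \<subseteq> A" for x A
      using that lin[OF that(1)]
      by (intro continuous_on_compose2[OF that(2)] linear_continuous_on) (auto simp: linear_linear)
    have cont_rot: "continuous_on (cball 0 R) (\<lambda>y. g (\<rho> x y))"
      "continuous_on (sphere 0 R) (\<lambda>y. g (\<rho> x y))" if "x \<in> X" for x
      using that by (auto intro!: cont\<rho> gc simp: norm)
    define g' where "g' y = (\<Sum>x\<in>X. g (\<rho> x y)) / K" for y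
    have "H g'"
      unfolding H_def
    proof (intro conjI ballI allI impI)
      show "continuous_on (cball 0 R) g'"
        unfolding g'_def using K
        by (intro continuous_on_divide continuous_on_sum cont_rot continuous_on_const) auto
      show "nonneg_trace_jet g' y" if "norm y < R" for y
      proof -
        have "nonneg_trace_jet (\<lambda>y. \<Sum>x\<in>X. g (\<rho> x y)) y"
        proof (rule nonneg_trace_jet_sum[OF X(1)])
          fix x assume "x \<in> X"
          then have "nonneg_trace_jet g (\<rho> x y)"
            using g that by (simp add: H_def norm)
          then show "nonneg_trace_jet (\<lambda>y. g (\<rho> x y)) y"
            by (rule nonneg_trace_jet_orthogonal[OF \<rho>(1)[OF \<open>x \<in> X\<close>]])
        qed
        then have "nonneg_trace_jet (\<lambda>y. inverse K * (\<Sum>x\<in>X. g (\<rho> x y))) y"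
          using K by (intro nonneg_trace_jet_cmult) auto
        then show ?thesis
          unfolding g'_def by (simp add: divide_inverse mult.commute)
      qed
      show "g' 0 = v 0"
        using g K by (simp add: g'_def linear_0[OF lin] H_def) (simp add: K_def)
      have "sphere_average g' R = (\<Sum>x\<in>X. sphere_average (\<lambda>y. g (\<rho> x y)) R) / K"
        unfolding g'_def sphere_average_divide
        by (subst sphere_average_sum[OF X(1) _ R]) (auto intro: cont_rot)
      also have "\<dots> = (\<Sum>x\<in>X. m0) / K"
        using g by (simp add: sphere_average_orthogonal[OF \<rho>(1) gc(2) R] H_def)
      also have "\<dots> = m0"
        using K by (simp add: K_def)
      finally show "sphere_average g' R = m0" .
      fix y z :: 'a assume yz: "y \<in> sphere 0 R" "z \<in> sphere 0 R" "dist y z < \<delta>"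
      have "\<bar>\<Sum>x\<in>X. g (\<rho> x y) - g (\<rho> x z)\<bar> \<le> (\<Sum>x\<in>X. \<eta> / 2)"
      proof (rule order_trans[OF sum_abs sum_mono])
        fix x assume "x \<in> X"
        then show "\<bar>g (\<rho> x y) - g (\<rho> x z)\<bar> \<le> \<eta> / 2"
          using g yz by (auto simp: H_def norm dist)
      qed
      then have "\<bar>(\<Sum>x\<in>X. g (\<rho> x y) - g (\<rho> x z)) / K\<bar> \<le> \<eta> / 2"
        using K by (simp add: K_def pos_divide_le_eq mult.commute)
      then show "\<bar>g' y - g' z\<bar> \<le> \<eta> / 2"
        by (simp add: g'_def sum_subtractf diff_divide_distrib)
    qed
    moreover have "g' y \<le> M - \<eta> / (2 * K)" if y: "y \<in> sphere 0 R" for y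
    proof -
      obtain x0 where x0: "x0 \<in> X" "dist x0 y < \<delta>"
        using X(3) y by auto
      have "\<bar>g (\<rho> x0 x0) - g (\<rho> x0 y)\<bar> \<le> \<eta> / 2"
        using g x0 X(2) y by (auto simp: H_def norm dist)
      then have "g (\<rho> x0 y) \<le> m0 + \<eta> / 2"
        using m(2) \<rho>(2)[OF x0(1)] by (simp only: abs_le_iff) argo
      also have "\<dots> \<le> M - \<eta> / 2"
      proof -
        have "v 0 \<le> M"
          using g bd by (rule above)
        then show ?thesis
          unfolding \<eta>_def by argo
      qed
      finally have small: "g (\<rho> x0 y) \<le> M - \<eta> / 2" .
      have "(\<Sum>x\<in>X. g (\<rho> x y)) = g (\<rho> x0 y) + (\<Sum>x\<in>X - {x0}. g (\<rho> x y))"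
        using X(1) x0(1) by (rule sum.remove)
      also have "\<dots> \<le> (M - \<eta> / 2) + (\<Sum>x\<in>X - {x0}. M)"
      proof (intro add_mono small sum_mono bd)
        fix x assume "x \<in> X - {x0}"
        then show "\<rho> x y \<in> sphere 0 R"
          using y by (simp add: norm)
      qed
      also have "\<dots> = K * M - \<eta> / 2"
      proof -
        have "card X = Suc (card (X - {x0}))"
          using X(1) x0(1) by (rule card.remove)
        then have "K = real (card (X - {x0})) + 1"
          unfolding K_def by linarith
        then show ?thesis by (simp add: algebra_simps)
      qed
      finally show ?thesis
        using K by (simp add: g'_def field_simps)
    qed
    ultimately show ?thesis by blast
  qed
  have "compact (v ` sphere 0 R)"
    using cont_sphere by (intro compact_continuous_image) auto
  then obtain M where M: "\<And>x. x \<in> sphere 0 R \<Longrightarrow> v x \<le> M"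
    using compact_imp_bounded[of "v ` sphere 0 R"] unfolding bounded_iff real_norm_def
    by (metis abs_le_D1 imageI)
  have iter: "\<exists>g. H g \<and> (\<forall>x\<in>sphere 0 R. g x \<le> M - real n * (\<eta> / (2 * K)))" for n
  proof (induction n)
    case 0
    have "H v"
      using cont jet unif by (force simp: H_def m0_def dist_real_def)
    then show ?case
      using M by auto
  next
    case (Suc n)
    then obtain g where g: "H g" "\<And>x. x \<in> sphere 0 R \<Longrightarrow> g x \<le> M - real n * (\<eta> / (2 * K))"
      by blast
    have "M - real n * (\<eta> / (2 * K)) - \<eta> / (2 * K) = M - real (Suc n) * (\<eta> / (2 * K))"
      by (simp only: of_nat_Suc distrib_right mult_1)
    with step[OF g] show ?case
      by (simp only:)
  qed
  have "\<eta> / (2 * K) > 0"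
    using \<eta> K by simp
  then obtain n where "M - v 0 < real n * (\<eta> / (2 * K))"
    using reals_Archimedean3 by blast
  moreover have "v 0 \<le> M - real n * (\<eta> / (2 * K))"
    using iter[of n] above by blast
  ultimately show False
    by simp
qed

lemma subharmonic_on_if_jets:
  fixes f :: "'a::euclidean_space \<Rightarrow> real"
  assumes W: "open W" "W \<noteq> {}" and cont: "continuous_on W f"
    and jet: "\<And>x. x \<in> W \<Longrightarrow> nonneg_trace_jet f x"
  shows "subharmonic_on W (\<lambda>x. ereal (f x))"
  unfolding subharmonic_on_def
proof (intro conjI allI impI)
  show "upper_semicontinuous_on W (\<lambda>x. ereal (f x))"
    unfolding upper_semicontinuous_on_def
  proof
    fix t
    have "continuous_on W (\<lambda>x. ereal (f x))"
      using cont by (intro continuous_intros)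
    then have "openin (top_of_set W) (W \<inter> (\<lambda>x. ereal (f x)) -` {..<t})"
      by (rule continuous_openin_preimage_gen) simp
    also have "W \<inter> (\<lambda>x. ereal (f x)) -` {..<t} = {x \<in> W. ereal (f x) < t}"
      by auto
    finally show "openin (top_of_set W) {x \<in> W. ereal (f x) < t}" .
  qed
  fix c r assume cr: "0 < r \<and> cball c r \<subseteq> W"
  have sub: "c + x \<in> W" if "norm x \<le> r" for x
    using cr that by (auto simp: dist_norm)
  have "f (c + 0) \<le> sphere_average (\<lambda>x. f (c + x)) r"
  proof (rule sphere_average_ge_center)
    show "continuous_on (cball 0 r) (\<lambda>x. f (c + x))"
      by (intro continuous_on_compose2[OF cont] continuous_intros) (use cr in \<open>auto simp: subset_eq\<close>)
  qed (use cr sub jet in \<open>auto intro!: nonneg_trace_jet_translate\<close>)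
  moreover have "continuous_on (sphere c r) f"
    by (rule continuous_on_subset[OF cont]) (use cr in \<open>auto simp: subset_eq\<close>)
  ultimately show "ereal (f c) \<le> sphere_mean (\<lambda>x. ereal (f x)) c r"
    using cr by (simp add: sphere_mean_eq_sphere_average)
qed (use W in auto)

section \<open>Pushing poles to infinity\<close>

text \<open>
  Taylor polynomials of odd degree lie below the exponential function on the whole line, because the
  remainder has even order.
\<close>

lemma exp_ge_cubic:
  fixes z :: real
  shows "1 + z + z\<^sup>2 / 2 + z ^ 3 / 6 \<le> exp z"
proof -
  obtain t where "exp z = (\<Sum>m<4. z ^ m / fact m) + exp t / fact 4 * z ^ 4"
    using Maclaurin_exp_le[of z 4] by blast
  moreover have "exp t / fact 4 * z ^ 4 \<ge> 0"
    by (intro mult_nonneg_nonneg) auto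
  ultimately show ?thesis
    by (simp add: eval_nat_numeral)
qed

text \<open>
  With \<open>b = a - q\<close> and \<open>z = -\<alpha> (2 b \<bullet> h + |h|\<^sup>2)\<close>, the value at \<open>a + h\<close> is \<open>exp (-\<alpha> |b|\<^sup>2) exp z\<close>.
  The terms of \<open>1 + z + z\<^sup>2/2\<close> up to second order give the jet, whose trace is a positive multiple of
  \<open>2 \<alpha> |b|\<^sup>2\<close> minus the dimension.
\<close>

lemma nonneg_trace_jet_gaussian:
  fixes a q :: "'a::euclidean_space"
  assumes \<alpha>: "\<alpha> > 0" and far: "real DIM('a) \<le> 2 * \<alpha> * (norm (a - q))\<^sup>2"
  shows "nonneg_trace_jet (\<lambda>x. exp (- \<alpha> * (norm (x - q))\<^sup>2)) a"
proof -
  define b where "b = a - q"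
  define G where "G = exp (- \<alpha> * (norm b)\<^sup>2)"
  define A where "A h = G *\<^sub>R ((2 * \<alpha>\<^sup>2 * (b \<bullet> h)) *\<^sub>R b - \<alpha> *\<^sub>R h)" for h
  have G: "G > 0" by (simp add: G_def)
  show ?thesis
  proof (rule nonneg_trace_jetI[of A _ _ "(- 2 * \<alpha> * G) *\<^sub>R b"])
    show "linear A"
      by (auto simp: A_def linear_iff inner_add_right algebra_simps)
    have "c \<bullet> A c = G * (2 * \<alpha>\<^sup>2 * ((b \<bullet> c) * (b \<bullet> c)) - \<alpha>)" if "c \<in> Basis" for c
      using that by (simp add: A_def inner_diff_right inner_commute[of c b])
    then have "(\<Sum>c\<in>Basis. c \<bullet> A c) = (\<Sum>c\<in>Basis. G * (2 * \<alpha>\<^sup>2 * ((b \<bullet> c) * (b \<bullet> c)) - \<alpha>))"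
      by simp
    also have "\<dots> = G * (2 * \<alpha>\<^sup>2 * (\<Sum>c\<in>Basis. (b \<bullet> c) * (b \<bullet> c)) - real DIM('a) * \<alpha>)"
      by (simp only: sum_distrib_left[symmetric] sum_subtractf sum_constant)
    also have "(\<Sum>c\<in>Basis. (b \<bullet> c) * (b \<bullet> c)) = (norm b)\<^sup>2"
      by (simp add: power2_norm_eq_inner euclidean_inner[of b b])
    also have "G * (2 * \<alpha>\<^sup>2 * (norm b)\<^sup>2 - real DIM('a) * \<alpha>) = G * \<alpha> * (2 * \<alpha> * (norm b)\<^sup>2 - real DIM('a))"
      by (simp add: algebra_simps power2_eq_square)
    finally show "0 \<le> (\<Sum>c\<in>Basis. c \<bullet> A c)"
      using G \<alpha> far by (simp add: b_def)
    fix e :: real assume e: "e > 0"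
    define k where "k = 2 * norm b + 1"
    define D where "D = G * (2 * \<alpha>\<^sup>2 * norm b + \<alpha> ^ 3 * k ^ 3 / 6)"
    have k: "k > 0" "k \<ge> 0" by (auto simp: k_def add_nonneg_pos)
    have D: "D \<ge> 0"
      using G \<alpha> k by (auto simp: D_def)
    have "\<forall>\<^sub>F h in nhds (0::'a). norm h < min 1 (e / (D + 1))"
      using e D by (auto simp: eventually_nhds_metric dist_norm intro!: exI[of _ "min 1 (e / (D + 1))"])
    then show "\<forall>\<^sub>F h in nhds 0. exp (- \<alpha> * (norm (a - q))\<^sup>2) + ((- 2 * \<alpha> * G) *\<^sub>R b) \<bullet> h + h \<bullet> A h
        - e * (norm h)\<^sup>2 \<le> exp (- \<alpha> * (norm (a + h - q))\<^sup>2)"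
    proof eventually_elim
      case (elim h)
      define n where "n = norm h"
      define s where "s = b \<bullet> h"
      define y where "y = 2 * s + n\<^sup>2"
      define z where "z = - \<alpha> * y"
      have n: "0 \<le> n" "n \<le> 1" "n * D \<le> e"
      proof -
        show "0 \<le> n" "n \<le> 1" using elim by (auto simp: n_def)
        have "n * (D + 1) \<le> e"
          using elim D by (simp add: n_def pos_less_divide_eq)
        then show "n * D \<le> e"
          using \<open>0 \<le> n\<close> by (simp add: algebra_simps)
      qed
      have s: "\<bar>s\<bar> \<le> norm b * n"
        unfolding s_def n_def by (rule Cauchy_Schwarz_ineq2)
      have "\<bar>y\<bar> \<le> 2 * \<bar>s\<bar> + n\<^sup>2"
        unfolding y_def by (rule order_trans[OF abs_triangle_ineq]) (simp add: abs_mult)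
      also have "\<dots> \<le> 2 * (norm b * n) + n * 1"
        using s n by (intro add_mono mult_left_mono) (auto simp: power2_eq_square mult_left_le)
      also have "\<dots> = k * n"
        by (simp add: k_def algebra_simps)
      finally have y: "\<bar>y\<bar> \<le> k * n" .
      have "\<bar>y ^ 3\<bar> \<le> (k * n) ^ 3"
        unfolding power_abs by (intro power_mono y) auto
      then have y3: "y ^ 3 \<le> k ^ 3 * n ^ 3"
        by (simp add: power_mult_distrib)
      have "\<bar>s * n\<^sup>2\<bar> \<le> norm b * n * n\<^sup>2"
        unfolding abs_mult using s by (intro mult_mono) auto
      then have sn: "- (norm b * n ^ 3) \<le> s * n\<^sup>2"
        by (simp add: power2_eq_square power3_eq_cube mult.assoc)
      have "- (2 * \<alpha>\<^sup>2 * norm b + \<alpha> ^ 3 * k ^ 3 / 6) * n ^ 3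
          = 2 * \<alpha>\<^sup>2 * (- (norm b * n ^ 3)) - \<alpha> ^ 3 * (k ^ 3 * n ^ 3) / 6"
        by (simp add: field_simps)
      also have "\<dots> \<le> 2 * \<alpha>\<^sup>2 * (s * n\<^sup>2) - \<alpha> ^ 3 * y ^ 3 / 6"
        using \<alpha> sn y3 by (intro diff_mono mult_left_mono divide_right_mono) auto
      also have "\<dots> \<le> 2 * \<alpha>\<^sup>2 * (s * n\<^sup>2) - \<alpha> ^ 3 * y ^ 3 / 6 + \<alpha>\<^sup>2 * (n\<^sup>2)\<^sup>2 / 2"
        by simp
      finally have rest: "- (2 * \<alpha>\<^sup>2 * norm b + \<alpha> ^ 3 * k ^ 3 / 6) * n ^ 3
          \<le> 2 * \<alpha>\<^sup>2 * (s * n\<^sup>2) - \<alpha> ^ 3 * y ^ 3 / 6 + \<alpha>\<^sup>2 * (n\<^sup>2)\<^sup>2 / 2" .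
      have zeq: "1 + z + z\<^sup>2 / 2 + z ^ 3 / 6 = 1 - 2 * \<alpha> * s - \<alpha> * n\<^sup>2 + 2 * \<alpha>\<^sup>2 * s\<^sup>2
          + (2 * \<alpha>\<^sup>2 * (s * n\<^sup>2) - \<alpha> ^ 3 * y ^ 3 / 6 + \<alpha>\<^sup>2 * (n\<^sup>2)\<^sup>2 / 2)"
        unfolding z_def by (simp add: power_mult_distrib) (simp add: y_def power2_eq_square power4_eq_xxxx algebra_simps)
      have "n * D * n\<^sup>2 \<le> e * n\<^sup>2"
        using n(3) by (intro mult_right_mono) auto
      then have "- (e * n\<^sup>2) \<le> G * (- (2 * \<alpha>\<^sup>2 * norm b + \<alpha> ^ 3 * k ^ 3 / 6) * n ^ 3)"
        by (simp add: D_def power2_eq_square power3_eq_cube algebra_simps)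
      also have "\<dots> \<le> G * (2 * \<alpha>\<^sup>2 * (s * n\<^sup>2) - \<alpha> ^ 3 * y ^ 3 / 6 + \<alpha>\<^sup>2 * (n\<^sup>2)\<^sup>2 / 2)"
        using rest G by (intro mult_left_mono) auto
      finally have "G * (1 - 2 * \<alpha> * s - \<alpha> * n\<^sup>2 + 2 * \<alpha>\<^sup>2 * s\<^sup>2) - e * n\<^sup>2 \<le> G * (1 + z + z\<^sup>2 / 2 + z ^ 3 / 6)"
        unfolding zeq by (simp add: distrib_left)
      also have "\<dots> \<le> G * exp z"
        using G exp_ge_cubic by (intro mult_left_mono) auto
      also have "G * exp z = exp (- \<alpha> * (norm (a + h - q))\<^sup>2)"
      proof -
        have "a + h - q = b + h" by (simp add: b_def)
        moreover have "(norm (b + h))\<^sup>2 = (norm b)\<^sup>2 + y"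
          by (simp add: power2_norm_eq_inner y_def s_def n_def inner_add_left inner_add_right inner_commute)
        ultimately show ?thesis
          by (simp add: G_def z_def exp_add[symmetric] algebra_simps)
      qed
      also have "G * (1 - 2 * \<alpha> * s - \<alpha> * n\<^sup>2 + 2 * \<alpha>\<^sup>2 * s\<^sup>2) - e * n\<^sup>2
          = exp (- \<alpha> * (norm (a - q))\<^sup>2) + ((- 2 * \<alpha> * G) *\<^sub>R b) \<bullet> h + h \<bullet> A h - e * (norm h)\<^sup>2"
      proof -
        have "h \<bullet> A h = G * (2 * \<alpha>\<^sup>2 * s\<^sup>2 - \<alpha> * n\<^sup>2)"
          by (simp add: A_def inner_diff_right s_def n_def power2_norm_eq_inner inner_commute[of h b] power2_eq_square[of "b \<bullet> h"])
        moreover have "exp (- \<alpha> * (norm (a - q))\<^sup>2) = G"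
          by (simp add: G_def b_def)
        ultimately show ?thesis
          by (simp add: s_def[symmetric] n_def[symmetric] algebra_simps)
      qed
      finally show ?case .
    qed
  qed
qed

text \<open>
  A substitute for a fundamental solution with pole \<open>q\<close>: large \<open>\<alpha>\<close> confines the region where the
  Gaussian is not subharmonic to an arbitrarily small ball about \<open>q\<close>.
\<close>

lemma gaussian_barrier:
  fixes q :: "'a::euclidean_space"
  assumes "\<rho> > 0" "d > 0"
  obtains w where "continuous_on UNIV w" and "\<And>x. \<rho> < dist x q \<Longrightarrow> nonneg_trace_jet w x"
    and "\<And>x. d \<le> dist x q \<Longrightarrow> w x \<le> 0" and "\<And>x. dist x q < d \<Longrightarrow> 0 < w x"
proof -
  define \<alpha> where "\<alpha> = real DIM('a) / (2 * \<rho>\<^sup>2)"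
  have \<alpha>: "\<alpha> > 0" and eq: "2 * \<alpha> * \<rho>\<^sup>2 = real DIM('a)"
    using assms by (auto simp: \<alpha>_def)
  define w where "w x = exp (- \<alpha> * (norm (x - q))\<^sup>2) + - exp (- \<alpha> * d\<^sup>2)" for x
  show thesis
  proof (rule that[of w])
    show "continuous_on UNIV w"
      unfolding w_def by (intro continuous_intros)
    fix x :: 'a
    show "nonneg_trace_jet w x" if "\<rho> < dist x q"
    proof -
      have "\<rho>\<^sup>2 \<le> (norm (x - q))\<^sup>2"
        using that assms by (intro power_mono) (auto simp: dist_norm)
      then have "2 * \<alpha> * \<rho>\<^sup>2 \<le> 2 * \<alpha> * (norm (x - q))\<^sup>2"
        using \<alpha> by (intro mult_left_mono) auto
      then show ?thesis
        unfolding w_def using \<alpha> eq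
        by (intro nonneg_trace_jet_add nonneg_trace_jet_const nonneg_trace_jet_gaussian) auto
    qed
    show "w x \<le> 0" if "d \<le> dist x q"
      using that assms \<alpha> by (auto simp: w_def dist_norm intro!: power_mono)
    show "0 < w x" if "dist x q < d"
      using that assms \<alpha> by (auto simp: w_def dist_norm intro!: power_strict_mono)
  qed
qed

lemma nonneg_trace_jet_norm_squared:
  "nonneg_trace_jet (\<lambda>x::'a::euclidean_space. (norm x)\<^sup>2) a"
proof (rule nonneg_trace_jetI[of "\<lambda>h. h" _ _ "2 *\<^sub>R a"])
  fix e :: real assume "e > 0"
  then show "\<forall>\<^sub>F h in nhds 0. (norm a)\<^sup>2 + (2 *\<^sub>R a) \<bullet> h + h \<bullet> h - e * (norm h)\<^sup>2 \<le> (norm (a + h))\<^sup>2"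
    by (intro always_eventually allI)
      (simp add: power2_norm_eq_inner inner_add_left inner_add_right inner_commute)
qed (auto simp: linear_iff)

text \<open>
  The function is finite at \<open>q\<close>; the "pole" is only a spot, as small as desired, where it may fail to
  be subharmonic.  Having \<open>u\<close> defined everywhere allows \<open>q\<close> to coincide with \<open>p\<close>.
\<close>

definition pole_pushable :: "'a::euclidean_space set \<Rightarrow> 'a \<Rightarrow> 'a \<Rightarrow> bool" where
  "pole_pushable K p q \<longleftrightarrow>
     (\<forall>\<rho>>0. \<exists>u. continuous_on UNIV u \<and> (\<forall>x. 0 \<le> u x) \<and> (\<forall>x\<in>K. u x = 0) \<and> 0 < u p \<and>
        (\<forall>x. \<rho> < dist x q \<longrightarrow> nonneg_trace_jet u x))"

text \<open>
  Around \<open>q\<close>, where \<open>u0\<close> may be bad, a large multiple of \<open>w\<close> exceeds \<open>u0\<close> and so is the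
  maximum of the two; elsewhere \<open>u0\<close> is good.  Hence the maximum is good wherever \<open>w\<close> is.
\<close>

lemma push_pole:
  fixes w :: "'a::euclidean_space \<Rightarrow> real"
  assumes "pole_pushable K p q" and cont: "continuous_on UNIV w"
    and K: "\<And>x. x \<in> K \<Longrightarrow> w x \<le> 0" and q: "0 < w q"
  obtains u where "continuous_on UNIV u" and "\<And>x. 0 \<le> u x" and "\<And>x. x \<in> K \<Longrightarrow> u x = 0"
    and "0 < u p" and "\<And>x. nonneg_trace_jet w x \<Longrightarrow> nonneg_trace_jet u x"
proof -
  have "isCont w q"
    using cont by (simp add: continuous_on_eq_continuous_at)
  then have "\<forall>\<^sub>F x in nhds q. w q / 2 < w x"
    using q unfolding isCont_def tendsto_at_iff_tendsto_nhds by (intro order_tendstoD) auto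
  then obtain r where r: "r > 0" "\<And>x. dist x q < r \<Longrightarrow> w q / 2 < w x"
    unfolding eventually_nhds_metric by blast
  obtain u0 where u0: "continuous_on UNIV u0" "\<And>x. 0 \<le> u0 x" "\<And>x. x \<in> K \<Longrightarrow> u0 x = 0" "0 < u0 p"
    "\<And>x. r / 2 < dist x q \<Longrightarrow> nonneg_trace_jet u0 x"
    using assms(1) r(1) unfolding pole_pushable_def by (metis half_gt_zero)
  have "compact (u0 ` cball q r)"
    using u0(1) by (intro compact_continuous_image) (auto intro: continuous_on_subset)
  then obtain M where M: "\<And>x. dist x q < r \<Longrightarrow> u0 x \<le> M"
    using compact_imp_bounded[of "u0 ` cball q r"] unfolding bounded_iff real_norm_def
    by (metis abs_le_D1 imageI dist_commute less_imp_le mem_cball)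
  have "M \<ge> 0"
    using M[of q] u0(2)[of q] r(1) by simp
  define c where "c = 2 * (M + 1) / w q"
  have c: "c > 0"
    using \<open>M \<ge> 0\<close> q by (simp add: c_def)
  define u where "u x = max (c * w x) (u0 x)" for x
  show thesis
  proof (rule that[of u])
    show "continuous_on UNIV u"
      unfolding u_def by (intro continuous_intros cont u0)
    fix x
    show "0 \<le> u x"
      using u0(2)[of x] by (simp add: u_def)
    show "u x = 0" if "x \<in> K"
      using K[OF that] u0(3)[OF that] c by (simp add: u_def max_def mult_le_0_iff)
    show "nonneg_trace_jet u x" if w: "nonneg_trace_jet w x"
    proof -
      have cw: "nonneg_trace_jet (\<lambda>x. c * w x) x"
        using w c by (intro nonneg_trace_jet_cmult) auto
      show ?thesis
      proof (cases "dist x q < r")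
        case True
        have above: "u0 y \<le> c * w y" if "dist y q < r" for y
        proof -
          have "M + 1 = c * (w q / 2)"
            using q by (simp add: c_def)
          also have "\<dots> \<le> c * w y"
            using r(2)[OF that] c by (intro mult_left_mono) auto
          finally show ?thesis
            using M[OF that] by simp
        qed
        show ?thesis
        proof (rule nonneg_trace_jet_below[OF cw])
          show "c * w x = u x"
            using above[OF True] by (simp add: u_def)
          show "\<forall>\<^sub>F y in nhds x. c * w y \<le> u y"
            by (simp add: u_def)
        qed
      next
        case False
        then show ?thesis
          unfolding u_def using r(1) by (intro nonneg_trace_jet_max cw u0(5)) auto
      qed
    qed
  qed (use u0(4) in \<open>simp add: u_def\<close>)
qed

lemma pole_pushable_start:
  assumes "closed K" "p \<notin> K"
  shows "pole_pushable K p p"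
  unfolding pole_pushable_def
proof (intro allI impI)
  fix \<rho> :: real assume "\<rho> > 0"
  obtain d where d: "d > 0" "ball p d \<subseteq> - K"
    using assms openE[of "- K" p] by auto
  obtain w where w: "continuous_on UNIV w" "\<And>x. \<rho> < dist x p \<Longrightarrow> nonneg_trace_jet w x"
    "\<And>x. d \<le> dist x p \<Longrightarrow> w x \<le> 0" "\<And>x. dist x p < d \<Longrightarrow> 0 < w x"
    using gaussian_barrier[OF \<open>\<rho> > 0\<close> d(1)] by metis
  have "w x \<le> 0" if "x \<in> K" for x
    using w(3)[of x] that d(2) by (force simp: dist_commute)
  moreover have "0 < w p"
    using w(4) d(1) by simp
  ultimately show "\<exists>u. continuous_on UNIV u \<and> (\<forall>x. 0 \<le> u x) \<and> (\<forall>x\<in>K. u x = 0) \<and> 0 < u p \<and>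
      (\<forall>x. \<rho> < dist x p \<longrightarrow> nonneg_trace_jet u x)"
    using w(1,2)
    by (intro exI[of _ "\<lambda>x. max 0 (w x)"])
      (auto intro!: continuous_intros nonneg_trace_jet_max nonneg_trace_jet_const max_absorb1)
qed

lemma pole_pushable_step:
  fixes K :: "'a::euclidean_space set"
  assumes q: "pole_pushable K p q" and d: "dist q q' < d" "ball q' d \<inter> K = {}"
  shows "pole_pushable K p q'"
  unfolding pole_pushable_def
proof (intro allI impI)
  fix \<rho> :: real assume "\<rho> > 0"
  have "d > 0"
    using d(1) zero_le_dist[of q q'] by linarith
  then obtain w where w: "continuous_on UNIV w" "\<And>x. \<rho> < dist x q' \<Longrightarrow> nonneg_trace_jet w x"
    "\<And>x. d \<le> dist x q' \<Longrightarrow> w x \<le> 0" "\<And>x. dist x q' < d \<Longrightarrow> 0 < w x"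
    using gaussian_barrier[OF \<open>\<rho> > 0\<close>] by metis
  have "w x \<le> 0" if "x \<in> K" for x
    using w(3)[of x] that d(2) by (force simp: dist_commute)
  then obtain u where "continuous_on UNIV u" "\<And>x. 0 \<le> u x" "\<And>x. x \<in> K \<Longrightarrow> u x = 0"
    "0 < u p" "\<And>x. nonneg_trace_jet w x \<Longrightarrow> nonneg_trace_jet u x"
    using push_pole[OF q w(1) _ w(4)[OF d(1)]] by metis
  then show "\<exists>u. continuous_on UNIV u \<and> (\<forall>x. 0 \<le> u x) \<and> (\<forall>x\<in>K. u x = 0) \<and> 0 < u p \<and>
      (\<forall>x. \<rho> < dist x q' \<longrightarrow> nonneg_trace_jet u x)"
    using w(2) by blast
qed

text \<open>
  The pole can be moved from \<open>p\<close> to \<open>z\<close> through the component of the complement of \<open>K\<close>.  Beyond a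
  ball containing \<open>K\<close> it is removed by \<open>|x|\<^sup>2 - R\<^sup>2\<close>, which has no bad spot at all.
\<close>

lemma escaping_function:
  fixes K :: "'a::euclidean_space set"
  assumes K: "closed K" "K \<subseteq> cball 0 R" and pz: "connected_component (- K) p z" and z: "R < norm z" and "0 \<le> R"
  obtains v where "continuous_on UNIV v" and "\<And>x. 0 \<le> v x" and "\<And>x. x \<in> K \<Longrightarrow> v x = 0"
    and "0 < v p" and "\<And>x. nonneg_trace_jet v x"
proof -
  define C where "C = connected_component_set (- K) p"
  have C: "connected C" "p \<in> C" "z \<in> C" "C \<subseteq> - K"
    using pz connected_component_refl[of p "- K"] connected_component_in[OF pz]
      connected_component_subset[of "- K" p] by (auto simp: C_def)
  have "pole_pushable K p z"
  proof (rule connected_induction_simple[OF C(1) C(2) C(3), where P = "pole_pushable K p"])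
    show "pole_pushable K p p"
      using C K(1) by (intro pole_pushable_start) auto
    fix a assume "a \<in> C"
    then obtain e where e: "e > 0" "ball a e \<subseteq> - K"
      using C(4) K(1) openE[of "- K" a] by auto
    have step: "pole_pushable K p y"
      if "x \<in> ball a (e / 3)" "y \<in> ball a (e / 3)" "pole_pushable K p x" for x y
    proof (rule pole_pushable_step[OF that(3)])
      show "dist x y < 2 * e / 3"
        using that dist_triangle2[of x y a] by (simp add: dist_commute)
      have "ball y (2 * e / 3) \<subseteq> ball a e"
      proof
        fix t assume "t \<in> ball y (2 * e / 3)"
        then show "t \<in> ball a e"
          using that(2) dist_triangle[of a t y] by simp
      qed
      then show "ball y (2 * e / 3) \<inter> K = {}"
        using e(2) by blast
    qed
    show "\<exists>T. openin (top_of_set C) T \<and> a \<in> T \<and>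
        (\<forall>x\<in>T. \<forall>y\<in>T. pole_pushable K p x \<longrightarrow> pole_pushable K p y)"
    proof (intro exI[of _ "C \<inter> ball a (e / 3)"] conjI ballI impI)
      show "openin (top_of_set C) (C \<inter> ball a (e / 3))"
        by (intro openin_open_Int) auto
      show "a \<in> C \<inter> ball a (e / 3)"
        using \<open>a \<in> C\<close> e(1) by simp
    qed (use step in blast)
  qed
  moreover have "continuous_on UNIV (\<lambda>x::'a. (norm x)\<^sup>2 + - R\<^sup>2)"
    by (intro continuous_intros)
  moreover have "(norm x)\<^sup>2 + - R\<^sup>2 \<le> 0" if "x \<in> K" for x
    using that K(2) by (auto intro!: power_mono)
  moreover have "0 < (norm z)\<^sup>2 + - R\<^sup>2"
    using z \<open>0 \<le> R\<close> by (simp add: power_strict_mono)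
  moreover have "nonneg_trace_jet (\<lambda>x::'a. (norm x)\<^sup>2 + - R\<^sup>2) x" for x
    by (intro nonneg_trace_jet_add nonneg_trace_jet_const nonneg_trace_jet_norm_squared)
  ultimately show thesis
    using push_pole[of K p z "\<lambda>x. (norm x)\<^sup>2 + - R\<^sup>2"] that by metis
qed

section \<open>Subharmonic functions with spikes along a closed set\<close>

text \<open>
  The function vanishes on \<open>A\<close>, the part of the ball at distance at least \<open>e\<close> from \<open>S\<close>, and on \<open>B\<close>, the
  part of \<open>S\<close> in the ball.  The points where it is large are taken off \<open>S\<close> but within \<open>e\<close> of a finite
  \<open>e\<close>-net of \<open>B\<close>; such a point \<open>p\<close> exists because \<open>S\<close> is nowhere dense.  It is not cut off from
  infinity: by \<open>A\<close> it is not, since a ball about a point \<open>s\<close> of \<open>S\<close> and the unbounded component of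
  \<open>s\<close> in \<open>S\<close> both avoid \<open>A\<close>; by \<open>B\<close> it is not, since the complement of \<open>S\<close> is connected and dense.
\<close>

lemma spiked_function:
  fixes S :: "'a::euclidean_space set"
  assumes S: "closed S" "nowhere_dense S"
    and unbdd: "\<forall>C\<in>components S. \<not> bounded C" and conn: "connected (UNIV - S)" and e: "e > 0"
  obtains v where "continuous_on UNIV v" and "\<And>x. 0 \<le> v x" and "\<And>x. nonneg_trace_jet v x"
    and "\<And>x. \<lbrakk>norm x \<le> r; x \<in> S \<or> (\<forall>s\<in>S. e \<le> dist x s)\<rbrakk> \<Longrightarrow> v x = 0"
    and "\<And>s. \<lbrakk>s \<in> S; norm s \<le> r\<rbrakk> \<Longrightarrow> \<exists>x. dist x s < 2 * e \<and> M \<le> v x"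
proof -
  define A where "A = cball 0 r \<inter> (\<Inter>s\<in>S. - ball s e)"
  define B where "B = S \<inter> cball 0 r"
  have closed: "closed A" "closed B"
    unfolding A_def B_def using S(1) by (auto intro!: closed_INT)
  have disj: "A \<inter> B = {}"
  proof -
    have "x \<notin> A" if "x \<in> S" for x
      using that e by (auto simp: A_def intro!: bexI[of _ x])
    then show ?thesis
      by (auto simp: B_def)
  qed
  have dense: "closure (UNIV - S) = UNIV"
    using S by (simp add: nowhere_dense_def Compl_eq_Diff_UNIV[symmetric] closure_complement)
  define R where "R = max r 0"
  have AB: "A \<union> B \<subseteq> cball 0 R"
    by (auto simp: A_def B_def R_def)
  have conB: "connected (- B)"
  proof (rule connected_intermediate_closure[OF conn])
    show "UNIV - S \<subseteq> - B" by (auto simp: B_def)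
  qed (simp add: dense)
  define good where "good v \<longleftrightarrow> continuous_on UNIV v \<and> (\<forall>x. 0 \<le> v x) \<and> (\<forall>x\<in>A \<union> B. v x = 0)
      \<and> (\<forall>x. nonneg_trace_jet v x)" for v
  have spike: "\<exists>v. good v \<and> M \<le> v p" if s: "s \<in> S" and p: "p \<notin> S" "dist p s < e" for p s
  proof -
    obtain C where C: "C \<in> components S" "s \<in> C"
      using s by (metis UnionE Union_components)
    then obtain z where z: "z \<in> C" "R < norm z"
      using unbdd unfolding bounded_iff by (meson not_le)
    have "C \<subseteq> S" "connected C"
      using C(1) in_components_subset in_components_connected by auto
    have pA: "connected_component (- A) p z"
    proof (rule connected_componentI)
      show "connected (C \<union> ball s e)"
        using \<open>connected C\<close> C(2) e by (intro connected_Un connected_ball) auto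
      show "C \<union> ball s e \<subseteq> - A"
        using \<open>C \<subseteq> S\<close> s e by (auto simp: A_def)
    qed (use p(2) z(1) in \<open>auto simp: dist_commute\<close>)
    have "z \<notin> B"
      using z(2) by (auto simp: B_def R_def)
    then have pB: "connected_component (- B) p z"
      using conB p(1) by (intro connected_componentI[of "- B"]) (auto simp: B_def)
    obtain v where v: "continuous_on UNIV v" "\<And>x. 0 \<le> v x" "\<And>x. x \<in> A \<union> B \<Longrightarrow> v x = 0"
      "0 < v p" "\<And>x. nonneg_trace_jet v x"
      using escaping_function[OF closed_Un[OF closed] AB
          separation_by_Un_closed_pointwise[OF closed disj pA pB] z(2)]
      by (auto simp: R_def)
    define c where "c = (\<bar>M\<bar> + 1) / v p"
    have c: "c > 0" "c * v p = \<bar>M\<bar> + 1"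
      using v(4) by (auto simp: c_def)
    show ?thesis
      unfolding good_def
    proof (intro exI[of _ "\<lambda>x. c * v x"] conjI allI ballI)
      show "M \<le> c * v p"
        using c(2) by simp
      show "continuous_on UNIV (\<lambda>x. c * v x)"
        by (intro continuous_intros v(1))
    qed (use v c in \<open>auto intro: nonneg_trace_jet_cmult\<close>)
  qed
  have "compact B"
    using closed(2) by (simp add: B_def compact_eq_bounded_closed bounded_Int)
  then obtain T where T: "finite T" "T \<subseteq> B" "B \<subseteq> (\<Union>t\<in>T. ball t e)"
    using compactE_image[of B B "\<lambda>t. ball t e"] e by (metis UN_I centre_in_ball open_ball subsetI)
  have "\<exists>p. p \<notin> S \<and> dist p t < e" for t
    using dense e by (metis DiffE UNIV_I closure_approachable)
  then obtain p where p: "\<And>t. p t \<notin> S" "\<And>t. dist (p t) t < e"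
    by metis
  have "\<forall>t\<in>T. \<exists>v. good v \<and> M \<le> v (p t)"
    using spike p T(2) by (auto simp: B_def)
  then obtain v where v': "\<And>t. t \<in> T \<Longrightarrow> good (v t) \<and> M \<le> v t (p t)"
    by metis
  have v: "\<And>t. t \<in> T \<Longrightarrow> continuous_on UNIV (v t)" "\<And>t x. t \<in> T \<Longrightarrow> 0 \<le> v t x"
    "\<And>t x. t \<in> T \<Longrightarrow> x \<in> A \<union> B \<Longrightarrow> v t x = 0" "\<And>t. t \<in> T \<Longrightarrow> M \<le> v t (p t)"
    "\<And>t x. t \<in> T \<Longrightarrow> nonneg_trace_jet (v t) x"
    using v' by (auto simp: good_def)
  show thesis
  proof (rule that[of "\<lambda>x. \<Sum>t\<in>T. v t x"])
    show "continuous_on UNIV (\<lambda>x. \<Sum>t\<in>T. v t x)"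
      by (intro continuous_on_sum v(1))
    fix x
    show "0 \<le> (\<Sum>t\<in>T. v t x)"
      by (intro sum_nonneg v(2))
    show "nonneg_trace_jet (\<lambda>x. \<Sum>t\<in>T. v t x) x"
      by (intro nonneg_trace_jet_sum T(1) v(5))
    show "(\<Sum>t\<in>T. v t x) = 0" if "norm x \<le> r" "x \<in> S \<or> (\<forall>s\<in>S. e \<le> dist x s)"
    proof -
      have "x \<in> A \<union> B"
        using that by (auto simp: A_def B_def dist_commute)
      then show ?thesis
        using v(3) by (intro sum.neutral) auto
    qed
  next
    fix s assume "s \<in> S" "norm s \<le> r"
    then obtain t where t: "t \<in> T" "dist t s < e"
      using T(3) by (auto simp: B_def)
    have "dist (p t) s < 2 * e"
      using p(2)[of t] t(2) dist_triangle[of "p t" s t] by simp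
    moreover have "M \<le> (\<Sum>t'\<in>T. v t' (p t))"
      using v(4)[OF t(1)] member_le_sum[of t T "\<lambda>t'. v t' (p t)"] v(2) t(1) T(1) by force
    ultimately show "\<exists>x. dist x s < 2 * e \<and> M \<le> (\<Sum>t\<in>T. v t x)"
      by blast
  qed
qed

text \<open>
  The zero set of \<open>v n\<close> grows with \<open>n\<close>: it contains both the part of \<open>S\<close> in the ball of radius \<open>n\<close>
  and what lies in that ball at distance at least \<open>1/(n+1)\<close> from \<open>S\<close>.  The bound \<open>n\<close> is reached near
  each point of \<open>S\<close> for all large \<open>n\<close>, not just for infinitely many, so that two such sequences
  are large at the same indices.
\<close>

lemma spiked_sequence:
  fixes S :: "'a::euclidean_space set"
  assumes S: "closed S" "nowhere_dense S"
    and unbdd: "\<forall>C\<in>components S. \<not> bounded C" and conn: "connected (UNIV - S)"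
  obtains v :: "nat \<Rightarrow> 'a \<Rightarrow> real"
  where "\<And>n. continuous_on UNIV (v n)" and "\<And>n x. 0 \<le> v n x" and "\<And>n x. nonneg_trace_jet (v n) x"
    and "\<And>a. \<exists>N. \<forall>n\<ge>N. v n a = 0"
    and "\<And>a. a \<notin> S \<Longrightarrow> \<exists>U N. open U \<and> a \<in> U \<and> (\<forall>x\<in>U. \<forall>n\<ge>N. v n x = 0)"
    and "\<And>a U. \<lbrakk>a \<in> S; open U; a \<in> U\<rbrakk> \<Longrightarrow> \<exists>N. \<forall>n\<ge>N. \<exists>x\<in>U. real n \<le> v n x"
proof -
  define good where "good n v \<longleftrightarrow> continuous_on UNIV v \<and> (\<forall>x. 0 \<le> v x) \<and> (\<forall>x. nonneg_trace_jet v x)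
    \<and> (\<forall>x. norm x \<le> real n \<and> (x \<in> S \<or> (\<forall>s\<in>S. inverse (real (Suc n)) \<le> dist x s)) \<longrightarrow> v x = 0)
    \<and> (\<forall>s. s \<in> S \<and> norm s \<le> real n \<longrightarrow> (\<exists>x. dist x s < 2 * inverse (real (Suc n)) \<and> real n \<le> v x))"
    for n and v :: "'a \<Rightarrow> real"
  have "\<exists>v. good n v" for n
    unfolding good_def
    by (rule spiked_function[OF S unbdd conn, of "inverse (real (Suc n))" "real n" "real n"]) (simp, blast)
  then obtain v where "\<And>n. good n (v n)"
    by metis
  then have v: "\<And>n. continuous_on UNIV (v n)" "\<And>n x. 0 \<le> v n x" "\<And>n x. nonneg_trace_jet (v n) x"
    and zero: "\<And>n x. \<lbrakk>norm x \<le> real n; x \<in> S \<or> (\<forall>s\<in>S. inverse (real (Suc n)) \<le> dist x s)\<rbrakk> \<Longrightarrow> v n x = 0"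
    and large: "\<And>n s. \<lbrakk>s \<in> S; norm s \<le> real n\<rbrakk> \<Longrightarrow> \<exists>x. dist x s < 2 * inverse (real (Suc n)) \<and> real n \<le> v n x"
    unfolding good_def by blast+
  have inv_small: "\<exists>N. \<forall>n\<ge>N. b \<le> real n \<and> inverse (real (Suc n)) < e" if e: "e > 0" for b e :: real
  proof -
    obtain k where k: "inverse (real (Suc k)) < e"
      using reals_Archimedean[OF e] by auto
    obtain m where m: "b \<le> real m"
      using real_arch_simple by blast
    have "b \<le> real n \<and> inverse (real (Suc n)) < e" if "n \<ge> max k m" for n
    proof -
      have "inverse (real (Suc n)) \<le> inverse (real (Suc k))"
        using that by (intro le_imp_inverse_le) auto
      with k have "inverse (real (Suc n)) < e"
        by linarith
      with m that show ?thesis by auto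
    qed
    then show ?thesis by blast
  qed
  have off: "\<exists>U N. open U \<and> a \<in> U \<and> (\<forall>x\<in>U. \<forall>n\<ge>N. v n x = 0)" if a: "a \<notin> S" for a
  proof -
    obtain d where d: "d > 0" "ball a d \<subseteq> - S"
      using S(1) a openE[of "- S" a] by auto
    obtain N where N: "\<And>n. n \<ge> N \<Longrightarrow> norm a + d \<le> real n \<and> inverse (real (Suc n)) < d / 2"
      using inv_small[of "d / 2" "norm a + d"] d(1) by auto
    have "v n x = 0" if x: "x \<in> ball a (d / 2)" and n: "n \<ge> N" for x n
    proof (rule zero)
      have "norm x \<le> norm a + dist a x"
        using norm_triangle_ineq[of a "x - a"] by (simp add: dist_norm norm_minus_commute)
      then show "norm x \<le> real n"
        using N[OF n] x d(1) by simp
      have "inverse (real (Suc n)) \<le> dist x s" if "s \<in> S" for s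
      proof -
        have "d \<le> dist a s"
          using d(2) that by (metis ComplD mem_ball not_le subsetD)
        also have "\<dots> \<le> dist a x + dist x s"
          by (rule dist_triangle)
        finally show ?thesis
          using N[OF n] x by simp
      qed
      then show "x \<in> S \<or> (\<forall>s\<in>S. inverse (real (Suc n)) \<le> dist x s)" by blast
    qed
    then show ?thesis
      using d(1) by (intro exI[of _ "ball a (d / 2)"] exI[of _ N]) auto
  qed
  show thesis
  proof (rule that[of v])
    show "\<exists>N. \<forall>n\<ge>N. v n a = 0" for a
    proof (cases "a \<in> S")
      case True
      obtain N where "norm a \<le> real N"
        using real_arch_simple by blast
      then show ?thesis
        using True by (intro exI[of _ N]) (auto intro!: zero order_trans[of "norm a" "real N"])
    next
      case False
      then show ?thesis
        using off by blast
    qed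
    show "\<exists>N. \<forall>n\<ge>N. \<exists>x\<in>U. real n \<le> v n x" if a: "a \<in> S" and U: "open U" "a \<in> U" for a U
    proof -
      obtain d where d: "d > 0" "ball a d \<subseteq> U"
        using U openE by blast
      obtain N where N: "\<And>n. n \<ge> N \<Longrightarrow> norm a \<le> real n \<and> inverse (real (Suc n)) < d / 2"
        using inv_small[of "d / 2" "norm a"] d(1) by auto
      have "\<exists>x\<in>U. real n \<le> v n x" if n: "n \<ge> N" for n
      proof -
        obtain x where x: "dist x a < 2 * inverse (real (Suc n))" "real n \<le> v n x"
          using large[OF a] N[OF n] by blast
        have "x \<in> ball a d"
          using x(1) N[OF n] by (simp add: dist_commute)
        with d(2) x(2) show ?thesis by blast
      qed
      then show ?thesis by blast
    qed
  qed (rule v off | assumption)+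
qed

section \<open>The separately subharmonic function\<close>

theorem theorem4p2:
  fixes S1 :: "'a::euclidean_space set" and S2 :: "'b::euclidean_space set"
  assumes "DIM('a) \<ge> 2" and "DIM('b) \<ge> 2"
    and "closed S1" and "closed S2"
    and "nowhere_dense S1" and "nowhere_dense S2"
    and "\<forall>C\<in>components S1. \<not> bounded C" and "\<forall>C\<in>components S2. \<not> bounded C"
    and "connected (UNIV - S1)" and "connected (UNIV - S2)"
  shows "\<exists>u :: 'a \<times> 'b \<Rightarrow> ereal.
           separately_subharmonic u \<and>
           subharmonic_on (UNIV - S1 \<times> S2) u \<and>
           (\<forall>z\<in>S1 \<times> S2. locally_unbounded_at u z)"
proof -
  obtain v :: "nat \<Rightarrow> 'a \<Rightarrow> real" where
    v: "\<And>n. continuous_on UNIV (v n)" "\<And>n x. 0 \<le> v n x" "\<And>n x. nonneg_trace_jet (v n) x"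
    and v0: "\<And>a. \<exists>N. \<forall>n\<ge>N. v n a = 0"
    and vloc: "\<And>a. a \<notin> S1 \<Longrightarrow> \<exists>U N. open U \<and> a \<in> U \<and> (\<forall>x\<in>U. \<forall>n\<ge>N. v n x = 0)"
    and vlarge: "\<And>a U. \<lbrakk>a \<in> S1; open U; a \<in> U\<rbrakk> \<Longrightarrow> \<exists>N. \<forall>n\<ge>N. \<exists>x\<in>U. real n \<le> v n x"
    by (rule spiked_sequence[OF assms(3,5,7,9)]) blast
  obtain w :: "nat \<Rightarrow> 'b \<Rightarrow> real" where
    w: "\<And>n. continuous_on UNIV (w n)" "\<And>n x. 0 \<le> w n x" "\<And>n x. nonneg_trace_jet (w n) x"
    and w0: "\<And>a. \<exists>N. \<forall>n\<ge>N. w n a = 0"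
    and wloc: "\<And>a. a \<notin> S2 \<Longrightarrow> \<exists>U N. open U \<and> a \<in> U \<and> (\<forall>x\<in>U. \<forall>n\<ge>N. w n x = 0)"
    and wlarge: "\<And>a U. \<lbrakk>a \<in> S2; open U; a \<in> U\<rbrakk> \<Longrightarrow> \<exists>N. \<forall>n\<ge>N. \<exists>x\<in>U. real n \<le> w n x"
    by (rule spiked_sequence[OF assms(4,6,8,10)]) blast
  define u where "u z = (\<Sum>n. v n (fst z) * w n (snd z))" for z
  have fin: "u z = (\<Sum>n<N. v n (fst z) * w n (snd z))"
    if "\<forall>n\<ge>N. v n (fst z) = 0 \<or> w n (snd z) = 0" for N z
    unfolding u_def using that by (intro suminf_finite) (auto simp: not_less)
  have "separately_subharmonic (\<lambda>z. ereal (u z))"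
    unfolding separately_subharmonic_def
  proof (intro allI conjI)
    fix a :: 'a and b :: 'b
    obtain N where N: "\<forall>n\<ge>N. w n b = 0" using w0 by blast
    have u_eq: "u (x, b) = (\<Sum>n<N. v n x * w n b)" for x
      using fin[of N "(x, b)"] N by simp
    have jet: "nonneg_trace_jet (\<lambda>x. v n x * w n b) x" for n x
      using nonneg_trace_jet_cmult[OF v(3)[of n x] w(2)[of n b]] by (simp only: mult.commute)
    show "subharmonic_on UNIV (\<lambda>x. ereal (u (x, b)))"
      unfolding u_eq
      by (rule subharmonic_on_if_jets) (auto intro!: continuous_intros v nonneg_trace_jet_sum jet)
    obtain N' where N': "\<forall>n\<ge>N'. v n a = 0" using v0 by blast
    have u_eq': "u (a, y) = (\<Sum>n<N'. v n a * w n y)" for y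
      using fin[of N' "(a, y)"] N' by simp
    have jet': "nonneg_trace_jet (\<lambda>y. v n a * w n y) y" for n y
      by (rule nonneg_trace_jet_cmult[OF w(3) v(2)])
    show "subharmonic_on UNIV (\<lambda>y. ereal (u (a, y)))"
      unfolding u_eq'
      by (rule subharmonic_on_if_jets) (auto intro!: continuous_intros w nonneg_trace_jet_sum jet')
  qed
  moreover have "subharmonic_on (UNIV - S1 \<times> S2) (\<lambda>z. ereal (u z))"
  proof -
    let ?W = "UNIV - S1 \<times> S2"
    have local: "\<exists>V N. open V \<and> z \<in> V \<and> (\<forall>z'\<in>V. u z' = (\<Sum>n<N. v n (fst z') * w n (snd z')))"
      if "z \<in> ?W" for z
    proof (cases "fst z \<in> S1")
      case False
      then obtain U N where "open U" "fst z \<in> U" "\<forall>x\<in>U. \<forall>n\<ge>N. v n x = 0"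
        using vloc by blast
      then show ?thesis
        by (intro exI[of _ "U \<times> UNIV"] exI[of _ N] conjI ballI fin) (auto intro: open_Times simp: mem_Times_iff)
    next
      case True
      then have "snd z \<notin> S2"
        using that by (auto simp: mem_Times_iff)
      then obtain U N where "open U" "snd z \<in> U" "\<forall>x\<in>U. \<forall>n\<ge>N. w n x = 0"
        using wloc by blast
      then show ?thesis
        by (intro exI[of _ "UNIV \<times> U"] exI[of _ N] conjI ballI fin) (auto intro: open_Times simp: mem_Times_iff)
    qed
    have cont: "continuous_on UNIV (\<lambda>z. \<Sum>n<N. v n (fst z) * w n (snd z))" for N
      by (intro continuous_intros continuous_on_compose2[OF v(1)] continuous_on_compose2[OF w(1)]) auto
    show ?thesis
    proof (rule subharmonic_on_if_jets)
      show "open ?W"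
        using assms(3,4) by (intro open_Diff closed_Times) auto
      have "S1 \<noteq> UNIV"
        using assms(5) by (auto simp: nowhere_dense_def)
      then show "?W \<noteq> {}"
        by auto
      show "continuous_on ?W u"
      proof (rule continuous_at_imp_continuous_on, rule ballI)
        fix z assume "z \<in> ?W"
        then obtain V N where VN: "open V" "z \<in> V" "\<forall>z'\<in>V. u z' = (\<Sum>n<N. v n (fst z') * w n (snd z'))"
          using local by blast
        have "continuous_on V u"
          using continuous_on_subset[OF cont[of N], of V] VN(3) by (simp cong: continuous_on_cong)
        then show "isCont u z"
          using VN(1,2) continuous_on_eq_continuous_at by blast
      qed
      fix z assume "z \<in> ?W"
      then obtain V N where VN: "open V" "z \<in> V" "\<forall>z'\<in>V. u z' = (\<Sum>n<N. v n (fst z') * w n (snd z'))"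
        using local by blast
      have "nonneg_trace_jet (\<lambda>z. \<Sum>n<N. v n (fst z) * w n (snd z)) (fst z, snd z)"
        by (intro nonneg_trace_jet_sum nonneg_trace_jet_mult v w) auto
      then show "nonneg_trace_jet u z"
        using VN eventually_nhds_in_open[OF VN(1,2)]
        by (intro nonneg_trace_jet_below[of _ z u]) (auto elim: eventually_mono)
    qed
  qed
  moreover have "locally_unbounded_at (\<lambda>z. ereal (u z)) z" if z: "z \<in> S1 \<times> S2" for z
    unfolding locally_unbounded_at_def
  proof (intro allI impI notI)
    fix U assume U: "open U \<and> z \<in> U" and "\<exists>M::real. \<forall>w\<in>U. ereal (u w) \<le> ereal M"
    then obtain M where M: "\<And>z'. z' \<in> U \<Longrightarrow> u z' \<le> M"
      by auto
    obtain A B where AB: "open A" "open B" "z \<in> A \<times> B" "A \<times> B \<subseteq> U"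
      using U open_prod_elim by metis
    obtain N1 where N1: "\<And>n. n \<ge> N1 \<Longrightarrow> \<exists>x\<in>A. real n \<le> v n x"
      using vlarge[of "fst z" A] z AB by (auto simp: mem_Times_iff)
    obtain N2 where N2: "\<And>n. n \<ge> N2 \<Longrightarrow> \<exists>x\<in>B. real n \<le> w n x"
      using wlarge[of "snd z" B] z AB by (auto simp: mem_Times_iff)
    obtain k where k: "M < real k"
      using reals_Archimedean2 by blast
    define n where "n = Suc (k + N1 + N2)"
    obtain x where x: "x \<in> A" "real n \<le> v n x"
      using N1[of n] by (auto simp: n_def)
    obtain y where y: "y \<in> B" "real n \<le> w n y"
      using N2[of n] by (auto simp: n_def)
    obtain N where N: "\<forall>m\<ge>N. v m x = 0"
      using v0 by blast
    have "M < real n * 1"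
      using k by (simp add: n_def)
    also have "\<dots> \<le> v n x * w n y"
      using x(2) y(2) by (intro mult_mono) (auto simp: n_def)
    also have "\<dots> \<le> (\<Sum>m<max N (Suc n). v m x * w m y)"
      using v(2) w(2) by (intro member_le_sum[of n _ "\<lambda>m. v m x * w m y"]) auto
    also have "\<dots> = u (x, y)"
      using fin[of "max N (Suc n)" "(x, y)"] N by simp
    also have "\<dots> \<le> M"
      using x(1) y(1) AB(4) by (intro M) auto
    finally show False by simp
  qed
  ultimately show ?thesis by blast
qed

end
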